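(* Let $k\ge 1$ be an integer and let $\mathbf E=(E_n)_{n\in\mathbb N}$ be a sequence of finite sets with $|E_n|\to\infty$. Let $\mathbf A=(A_n)$ be a densable sequence of permutation invariant random subsets of $\mathbf E$ with density $0<d<1$. Let $\mathbf X=(X_n)$ be a densable sequence of fixed (deterministic) subsets of $\mathbf E^{(k)}=(E_n^{(k)})$ with density $\alpha$. (i) If $d+\alpha<1$, then asymptotically almost surely $A_n^{(k)}\cap X_n=\emptyset$. (ii) If $d+\alpha>1$ and $\mathbf X$ satisfies the $d$-small self-intersection condition, then the sequence of random subsets $\mathbf A^{(k)}\cap\mathbf X=(A_n^{(k)}\cap X_n)$ of $\mathbf E^{(k)}$ is densable and $$\operatorname{dens}_{\mathbf E^{(k)}}(\mathbf A^{(k)}\cap\mathbf X)=\alpha+d-1.$$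
   Context: For a finite set $E$ (with $|E|\ge 2$) and $a\subseteq E$, $\operatorname{dens}_E(a)=\log_{|E|}|a|\in\{-\infty\}\cup[0,1]$, with $\log 0=-\infty$. A random subset of $E$ is a random variable with values in the power set $\mathcal P(E)$; it is permutation invariant if $\Pr(A=a)=\Pr(A=\sigma(a))$ for all $a\subseteq E$ and all permutations $\sigma$ of $E$. A sequence $(A_n)$, with $A_n$ a random subset of $E_n$, is densable with density $d\in\{-\infty\}\cup[0,1]$ if $\log_{|E_n|}|A_n|$ converges in distribution to the constant $d$; a sequence of fixed subsets $(a_n)$ is densable with density $d$ if $\log_{|E_n|}|a_n|\to d$. An event $Q_n$ holds asymptotically almost surely (a.a.s.) if $\Pr(Q_n)\to1$ as $n\to\infty$. For a set $S$, $S^{(k)}=\{(x_1,\dots,x_k)\in S^k : x_i\ne x_j \text{ for } i\neq j\}$; thus $A_n^{(k)}$ is a random subset of $E_n^{(k)}$. Self-intersection: for $x=(x_1,\dots,x_k)$ and $y=(y_1,\dots,y_k)$ in $E_n^{(k)}$, $|x\cap y|$ is the number of common elements of $\{x_1,\dots,x_k\}$ and $\{y_1,\dots,y_k\}$. For $0\le i\le k$ put $Y_{i,n}=\{(x,y)\in X_n^2 : |x\cap y|=i\}$ and $\mathbf Y_i=(Y_{i,n})_n$, a sequence of subsets of $(\mathbf E^{(k)})^2=((E_n^{(k)})^2)_n$. The upper density is $\overline{\operatorname{dens}}_{(\mathbf E^{(k)})^2}\mathbf Y_i=\limsup_{n\to\infty}\log_{|E_n^{(k)}|^2}|Y_{i,n}|$.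 For $\mathbf X$ densable with density $\alpha$ and $d>1-\alpha$, $\mathbf X$ satisfies the $d$-small self-intersection condition if for every $1\le i\le k-1$, $$\overline{\operatorname{dens}}_{(\mathbf E^{(k)})^2}(\mathbf Y_i)<\alpha-(1-d)\cdot\frac{i}{2k}.$$ (For $k=1$ this condition is vacuous.) *)

theory Defs
  imports "HOL-Probability.Probability" "HOL-Combinatorics.Permutations"
begin

text \<open>The empty set is treated separately because \<^term>\<open>log b 0 = 0\<close> in the library,
  whereas here \<open>log 0 = -\<infinity>\<close>. For \<open>card E < 2\<close> the value is irrelevant: all notions below
  depend only on large \<open>n\<close>, and are used for \<open>card (E n)\<close> tending to infinity.\<close>

definition dens :: "'b set \<Rightarrow> 'b set \<Rightarrow> ereal" where
  "dens E a = (if a = {} then -\<infinity> else ereal (log (real (card E)) (real (card a))))"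

definition density_values :: "ereal set" where
  "density_values = {-\<infinity>} \<union> {0..1}"

definition random_subset :: "'w measure \<Rightarrow> 'b set \<Rightarrow> ('w \<Rightarrow> 'b set) \<Rightarrow> bool" where
  "random_subset M E A \<longleftrightarrow> prob_space M \<and> A \<in> M \<rightarrow>\<^sub>M count_space (Pow E)"

definition permutation_invariant :: "'w measure \<Rightarrow> 'b set \<Rightarrow> ('w \<Rightarrow> 'b set) \<Rightarrow> bool" where
  "permutation_invariant M E A \<longleftrightarrow>
     (\<forall>\<sigma> a. \<sigma> permutes E \<longrightarrow> a \<subseteq> E \<longrightarrow>
        measure M {\<omega> \<in> space M. A \<omega> = a} = measure M {\<omega> \<in> space M. A \<omega> = \<sigma> ` a})"

text \<open>Weak convergence of measures on an arbitrary topological space, tested against bounded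
  continuous functions. The library's \<^const>\<open>weak_conv_m\<close> covers the real line only, but
  densities may take the value \<open>-\<infinity>\<close>.\<close>

definition weakly_converges ::
  "(nat \<Rightarrow> 'c::topological_space measure) \<Rightarrow> 'c measure \<Rightarrow> bool" where
  "weakly_converges \<mu> \<nu> \<longleftrightarrow>
     (\<forall>f :: 'c \<Rightarrow> real. continuous_on UNIV f \<longrightarrow> bounded (range f) \<longrightarrow>
        (\<lambda>n. integral\<^sup>L (\<mu> n) f) \<longlonglongrightarrow> integral\<^sup>L \<nu> f)"

text \<open>Convergence in distribution of the densities to the constant \<open>d\<close>. The set
  \<^const>\<open>density_values\<close> is closed in the extended reals, so weak convergence there is the same
  as weak convergence on its subspace topology. Each random subset may live on its own
  probability space.\<close>

definition random_densable ::
  "(nat \<Rightarrow> 'w measure) \<Rightarrow> (nat \<Rightarrow> 'b set) \<Rightarrow> (nat \<Rightarrow> 'w \<Rightarrow> 'b set) \<Rightarrow> ereal \<Rightarrow> bool" where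
  "random_densable M E A d \<longleftrightarrow>
     (\<forall>n. random_subset (M n) (E n) (A n)) \<and> d \<in> density_values \<and>
     weakly_converges (\<lambda>n. distr (M n) borel (\<lambda>\<omega>. dens (E n) (A n \<omega>))) (return borel d)"

definition densable :: "(nat \<Rightarrow> 'b set) \<Rightarrow> (nat \<Rightarrow> 'b set) \<Rightarrow> ereal \<Rightarrow> bool" where
  "densable E a d \<longleftrightarrow>
     (\<forall>n. a n \<subseteq> E n) \<and> d \<in> density_values \<and> (\<lambda>n. dens (E n) (a n)) \<longlonglongrightarrow> d"

definition upper_dens :: "(nat \<Rightarrow> 'b set) \<Rightarrow> (nat \<Rightarrow> 'b set) \<Rightarrow> ereal" where
  "upper_dens E a = limsup (\<lambda>n. dens (E n) (a n))"

definition asymptotically_almost_surely ::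
  "(nat \<Rightarrow> 'w measure) \<Rightarrow> (nat \<Rightarrow> 'w \<Rightarrow> bool) \<Rightarrow> bool" where
  "asymptotically_almost_surely M Q \<longleftrightarrow>
     (\<lambda>n. measure (M n) {\<omega> \<in> space (M n). Q n \<omega>}) \<longlonglongrightarrow> 1"

text \<open>The set \<open>S\<^sup>(\<^sup>k\<^sup>)\<close> of \<open>k\<close>-tuples of pairwise distinct elements, as lists.\<close>

definition distinct_tuples :: "nat \<Rightarrow> 'a set \<Rightarrow> 'a list set" where
  "distinct_tuples k S = {xs. length xs = k \<and> set xs \<subseteq> S \<and> distinct xs}"

definition self_intersection :: "'a list set \<Rightarrow> nat \<Rightarrow> ('a list \<times> 'a list) set" where
  "self_intersection X i = {(x, y). x \<in> X \<and> y \<in> X \<and> card (set x \<inter> set y) = i}"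

definition small_self_intersection ::
  "nat \<Rightarrow> (nat \<Rightarrow> 'a set) \<Rightarrow> (nat \<Rightarrow> 'a list set) \<Rightarrow> ereal \<Rightarrow> real \<Rightarrow> bool" where
  "small_self_intersection k E X \<alpha> d \<longleftrightarrow>
     (\<forall>i. 1 \<le> i \<and> i \<le> k - 1 \<longrightarrow>
        upper_dens (\<lambda>n. distinct_tuples k (E n) \<times> distinct_tuples k (E n))
            (\<lambda>n. self_intersection (X n) i)
          < \<alpha> - ereal ((1 - d) * (real i / (2 * real k))))"

end

theory Submission
  imports Defs
begin

text \<open>Permutation invariance makes \<open>A\<close> uniform given \<open>m = |A|\<close>, so it suffices to count, among the
  \<open>m\<close>-subsets of \<open>E\<close> with \<open>m = N\<^bsup>d+o(1)\<^esup>\<close>, \<open>N = |E|\<close>, those with an atypical value of \<open>Z = |A\<^sup>(\<^sup>k\<^sup>) \<inter> X|\<close>.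
  The mean of \<open>Z\<close> is about \<open>|X| (m/N)\<^sup>k\<close>, which tends to \<open>0\<close> when \<open>d + \<alpha> < 1\<close>. A pair \<open>(x, y)\<close> in
  \<open>Y\<^sub>i\<close> contributes about \<open>(m/N)\<^bsup>2k-i\<^esup>\<close> to the second moment, and the pairs in \<open>Y\<^sub>0\<close> are negatively
  correlated, so the relative variance is at most about \<open>(\<Sum>i=1..k. |Y\<^sub>i| (N/m)\<^sup>i) / |X|\<^sup>2\<close>. The small
  self-intersection condition is what makes the terms with \<open>i < k\<close> vanish; the term \<open>i = k\<close> vanishes
  because \<open>|Y\<^sub>k| \<le> k\<^sup>k |X|\<close> and \<open>d + \<alpha> > 1\<close>. Chebyshev's inequality then gives \<open>Z = N\<^bsup>k(\<alpha>+d-1)+o(1)\<^esup>\<close>.\<close>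

section \<open>Moments of the tuple count over subsets of fixed size\<close>

text \<open>The proportion of the \<open>m\<close>-subsets of an \<open>N\<close>-set that contain \<open>j\<close> prescribed elements.\<close>

definition falling_ratio :: "nat \<Rightarrow> nat \<Rightarrow> nat \<Rightarrow> real" where
  "falling_ratio N m j = (\<Prod>i<j. (real m - real i) / (real N - real i))"

section \<open>Bounds on the falling ratio\<close>

lemma falling_ratio_pos:
  assumes "j \<le> m" "m \<le> N" shows "0 < falling_ratio N m j"
  unfolding falling_ratio_def using assms by (intro prod_pos) auto

text \<open>Subtracting the same i from both parts of a fraction that is at most 1 can only decrease
  it, so every factor is at most m/N.\<close>

lemma falling_ratio_le_power:
  assumes "j \<le> m" "m \<le> N"
  shows "falling_ratio N m j \<le> (real m / real N) ^ j"
proof -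
  have "falling_ratio N m j \<le> (\<Prod>i<j. real m / real N)"
    unfolding falling_ratio_def
  proof (intro prod_mono conjI)
    fix i assume i: "i \<in> {..<j}"
    show "0 \<le> (real m - real i) / (real N - real i)" using i assms by auto
    have "real i * real m \<le> real i * real N" using assms by (intro mult_left_mono) auto
    then show "(real m - real i) / (real N - real i) \<le> real m / real N"
      using i assms by (simp add: divide_simps) (simp add: algebra_simps)
  qed
  then show ?thesis by simp
qed

text \<open>Since 2j \<le> m, each numerator m - i stays above m/2, and the denominators are at most
  N. The loss of 2^j is a constant factor, invisible to densities.\<close>

lemma power_le_falling_ratio:
  assumes "2 * j \<le> m" "m \<le> N"
  shows "(real m / (2 * real N)) ^ j \<le> falling_ratio N m j"
proof -
  have "(\<Prod>i<j. real m / (2 * real N)) \<le> falling_ratio N m j"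
    unfolding falling_ratio_def
  proof (intro prod_mono conjI)
    fix i assume i: "i \<in> {..<j}"
    show "0 \<le> real m / (2 * real N)" by simp
    have "real m / (2 * real N) = (real m / 2) / real N" by simp
    also have "\<dots> \<le> (real m - real i) / (real N - real i)"
      using i assms by (intro frac_le) auto
    finally show "real m / (2 * real N) \<le> (real m - real i) / (real N - real i)" .
  qed
  then show ?thesis by simp
qed

text \<open>Negative correlation: containing one k-set makes containing a disjoint k-set no more
  likely. Factor k + i is compared with factor i, and is no larger because m \<le> N.\<close>

lemma falling_ratio_double_le:
  assumes "2 * k \<le> m" "m \<le> N"
  shows "falling_ratio N m (2 * k) \<le> (falling_ratio N m k)\<^sup>2"
proof -
  have "falling_ratio N m (k + k) =
      falling_ratio N m k * (\<Prod>i<k. (real m - real (k + i)) / (real N - real (k + i)))"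
  proof -
    have "(\<Prod>i<k + l. f i) = (\<Prod>i<k. f i) * (\<Prod>i<l. f (k + i))" for f :: "nat \<Rightarrow> real" and l
      by (induction l) (simp_all add: mult.assoc)
    then show ?thesis unfolding falling_ratio_def .
  qed
  also have "\<dots> \<le> falling_ratio N m k * falling_ratio N m k"
  proof (intro mult_left_mono)
    show "(\<Prod>i<k. (real m - real (k + i)) / (real N - real (k + i))) \<le> falling_ratio N m k"
      unfolding falling_ratio_def
    proof (intro prod_mono conjI)
      fix i assume i: "i \<in> {..<k}"
      show "0 \<le> (real m - real (k + i)) / (real N - real (k + i))" using i assms by auto
      have "real k * real m \<le> real k * real N" using assms by (intro mult_left_mono) auto
      then show "(real m - real (k + i)) / (real N - real (k + i)) \<le> (real m - real i) / (real N - real i)"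
        using i assms by (simp add: divide_simps) (simp add: algebra_simps)
    qed
    show "0 \<le> falling_ratio N m k" using falling_ratio_pos[of k m N] assms by auto
  qed
  finally show ?thesis by (simp add: power2_eq_square mult_2)
qed

section \<open>Counting subsets that contain a prescribed set\<close>

text \<open>Each induction step is the absorption identity for binomial coefficients, which
  contributes the factor (m - j)/(N - j).\<close>

lemma binomial_eq_falling_ratio:
  assumes "j \<le> m" "m \<le> N"
  shows "real ((N - j) choose (m - j)) = falling_ratio N m j * real (N choose m)"
  using assms
proof (induction j)
  case 0
  then show ?case by (simp add: falling_ratio_def)
next
  case (Suc j)
  have "(m - j) * ((N - j) choose (m - j)) = (N - j) * ((N - Suc j) choose (m - Suc j))"
  proof -
    have "Suc (m - Suc j) = m - j" "N - j - 1 = N - Suc j" using Suc.prems by auto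
    then show ?thesis using binomial_absorption[of "m - Suc j" "N - j"] by metis
  qed
  then have "(real m - real j) * real ((N - j) choose (m - j)) =
      (real N - real j) * real ((N - Suc j) choose (m - Suc j))"
    using Suc.prems by (metis Suc_leD le_trans of_nat_diff of_nat_mult)
  then show ?case
    using Suc by (simp add: falling_ratio_def divide_simps) (simp add: algebra_simps)
qed

lemma card_supersets:
  assumes "finite E" "S \<subseteq> E" "card S \<le> m"
  shows "card {a. a \<subseteq> E \<and> card a = m \<and> S \<subseteq> a} = (card E - card S) choose (m - card S)"
proof -
  have fS: "finite S" using assms finite_subset by blast
  have "bij_betw (\<lambda>a. a - S) {a. a \<subseteq> E \<and> card a = m \<and> S \<subseteq> a} {b. b \<subseteq> E - S \<and> card b = m - card S}"
  proof (rule bij_betw_byWitness[where f' = "\<lambda>b. b \<union> S"])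
    show "(\<lambda>a. a - S) ` {a. a \<subseteq> E \<and> card a = m \<and> S \<subseteq> a} \<subseteq> {b. b \<subseteq> E - S \<and> card b = m - card S}"
      using fS by (auto simp: card_Diff_subset)
    show "(\<lambda>b. b \<union> S) ` {b. b \<subseteq> E - S \<and> card b = m - card S} \<subseteq> {a. a \<subseteq> E \<and> card a = m \<and> S \<subseteq> a}"
    proof clarsimp
      fix b assume b: "b \<subseteq> E - S" "card b = m - card S"
      then have "finite b" "b \<inter> S = {}" using assms finite_subset by blast+
      then show "b \<subseteq> E \<and> S \<subseteq> E \<and> card (b \<union> S) = m"
        using b assms fS by (auto simp: card_Un_disjoint)
    qed
  qed auto
  then have "card {a. a \<subseteq> E \<and> card a = m \<and> S \<subseteq> a} = card {b. b \<subseteq> E - S \<and> card b = m - card S}"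
    by (rule bij_betw_same_card)
  also have "\<dots> = (card E - card S) choose (m - card S)"
    using assms fS by (simp add: n_subsets card_Diff_subset)
  finally show ?thesis .
qed

section \<open>First and second moments of the number of tuples\<close>

lemma finite_distinct_tuples: "finite S \<Longrightarrow> finite (distinct_tuples k S)"
  unfolding distinct_tuples_def
  by (rule finite_subset[OF _ finite_lists_length_eq[of S k]]) auto

lemma distinct_tuples_Int:
  assumes "X \<subseteq> distinct_tuples k E"
  shows "distinct_tuples k a \<inter> X = {x \<in> X. set x \<subseteq> a}"
  using assms by (auto simp: distinct_tuples_def)

text \<open>Linearity of expectation: after swapping the sums, each tuple x asks how many m-sets
  contain the k elements of x.\<close>

lemma sum_card_tuples:
  assumes E: "finite E" and X: "X \<subseteq> distinct_tuples k E" and m: "k \<le> m" "m \<le> card E"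
  shows "(\<Sum>a | a \<subseteq> E \<and> card a = m. real (card (distinct_tuples k a \<inter> X))) =
    real (card X) * falling_ratio (card E) m k * real (card E choose m)"
proof -
  have fX: "finite X" using X E finite_distinct_tuples finite_subset by blast
  have fP: "finite {a. a \<subseteq> E \<and> card a = m}" using E by auto
  have "(\<Sum>a | a \<subseteq> E \<and> card a = m. real (card (distinct_tuples k a \<inter> X))) =
      (\<Sum>a | a \<subseteq> E \<and> card a = m. \<Sum>x\<in>X. of_bool (set x \<subseteq> a))"
    unfolding distinct_tuples_Int[OF X] using fX by (simp add: Int_def)
  also have "\<dots> = (\<Sum>x\<in>X. \<Sum>a | a \<subseteq> E \<and> card a = m. of_bool (set x \<subseteq> a))"
    by (rule sum.swap)
  also have "\<dots> = (\<Sum>x\<in>X. falling_ratio (card E) m k * real (card E choose m))"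
  proof (intro sum.cong refl)
    fix x assume "x \<in> X"
    then have x: "set x \<subseteq> E" "card (set x) = k"
      using X by (auto simp: distinct_tuples_def distinct_card)
    have "(\<Sum>a | a \<subseteq> E \<and> card a = m. of_bool (set x \<subseteq> a)) =
        real (card {a. a \<subseteq> E \<and> card a = m \<and> set x \<subseteq> a})"
      using fP by (simp add: Int_def conj_assoc)
    also have "\<dots> = falling_ratio (card E) m k * real (card E choose m)"
      using card_supersets[OF E x(1), of m] x m by (simp add: binomial_eq_falling_ratio)
    finally show "(\<Sum>a | a \<subseteq> E \<and> card a = m. of_bool (set x \<subseteq> a)) =
      falling_ratio (card E) m k * real (card E choose m)" .
  qed
  finally show ?thesis by simp
qed

text \<open>The square counts ordered pairs of tuples lying in \<open>a\<close>. A pair with i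
  common elements has a union of 2k - i elements, and that number alone decides how many m-sets
  contain it; hence the grouping by i.\<close>

lemma sum_card_tuples_square:
  assumes E: "finite E" and X: "X \<subseteq> distinct_tuples k E" and m: "2 * k \<le> m" "m \<le> card E"
  shows "(\<Sum>a | a \<subseteq> E \<and> card a = m. (real (card (distinct_tuples k a \<inter> X)))\<^sup>2) =
    (\<Sum>i\<le>k. real (card (self_intersection X i)) * falling_ratio (card E) m (2 * k - i)) *
      real (card E choose m)"
proof -
  have fX: "finite X" using X E finite_distinct_tuples finite_subset by blast
  have fP: "finite {a. a \<subseteq> E \<and> card a = m}" using E by auto
  have XD: "set x \<subseteq> E" "card (set x) = k" if "x \<in> X" for x
    using that X by (auto simp: distinct_tuples_def distinct_card)
  let ?g = "\<lambda>p::'a list \<times> 'a list. card (set (fst p) \<inter> set (snd p))"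
  let ?h = "\<lambda>p::'a list \<times> 'a list. falling_ratio (card E) m (2 * k - ?g p) * real (card E choose m)"
  have sq: "(real (card (distinct_tuples k a \<inter> X)))\<^sup>2 =
      (\<Sum>p\<in>X \<times> X. of_bool (set (fst p) \<union> set (snd p) \<subseteq> a))" for a
  proof -
    have "(real (card (distinct_tuples k a \<inter> X)))\<^sup>2 =
       real (card ({x \<in> X. set x \<subseteq> a} \<times> {x \<in> X. set x \<subseteq> a}))"
      by (simp add: distinct_tuples_Int[OF X] card_cartesian_product power2_eq_square)
    also have "{x \<in> X. set x \<subseteq> a} \<times> {x \<in> X. set x \<subseteq> a} =
        (X \<times> X) \<inter> {p. set (fst p) \<union> set (snd p) \<subseteq> a}" by auto
    also have "real (card \<dots>) = (\<Sum>p\<in>X \<times> X. of_bool (set (fst p) \<union> set (snd p) \<subseteq> a))"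
      using fX by (subst sum_of_bool_eq) auto
    finally show ?thesis .
  qed
  have "(\<Sum>a | a \<subseteq> E \<and> card a = m. (real (card (distinct_tuples k a \<inter> X)))\<^sup>2) =
      (\<Sum>p\<in>X \<times> X. \<Sum>a | a \<subseteq> E \<and> card a = m. of_bool (set (fst p) \<union> set (snd p) \<subseteq> a))"
    unfolding sq by (rule sum.swap)
  also have "\<dots> = (\<Sum>p\<in>X \<times> X. ?h p)"
  proof (intro sum.cong refl)
    fix p assume p: "p \<in> X \<times> X"
    let ?S = "set (fst p) \<union> set (snd p)"
    have S: "?S \<subseteq> E" using p XD by (auto simp: mem_Times_iff) 
    have "card (set (fst p)) = k" "card (set (snd p)) = k" using p XD by (auto simp: mem_Times_iff)
    then have c: "card ?S = 2 * k - ?g p"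
      using card_Un_Int[of "set (fst p)" "set (snd p)"] by simp
    have "(\<Sum>a | a \<subseteq> E \<and> card a = m. of_bool (?S \<subseteq> a)) =
        real (card {a. a \<subseteq> E \<and> card a = m \<and> ?S \<subseteq> a})"
      using fP by (subst sum_of_bool_eq) (auto simp: Int_def conj_assoc)
    also have "\<dots> = ?h p"
      using card_supersets[OF E S, of m] c m by (simp add: binomial_eq_falling_ratio)
    finally show "(\<Sum>a | a \<subseteq> E \<and> card a = m. of_bool (?S \<subseteq> a)) = ?h p" .
  qed
  also have "\<dots> = (\<Sum>i\<le>k. \<Sum>p | p \<in> X \<times> X \<and> ?g p = i. ?h p)"
  proof (rule sum.group[symmetric])
    have "?g p \<le> k" if "p \<in> X \<times> X" for p
      using card_mono[of "set (fst p)" "set (fst p) \<inter> set (snd p)"] that XD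
      by (auto simp: mem_Times_iff)
    then show "?g ` (X \<times> X) \<subseteq> {..k}" by blast
  qed (use fX in auto)
  also have "\<dots> = (\<Sum>i\<le>k. real (card (self_intersection X i)) *
      (falling_ratio (card E) m (2 * k - i) * real (card E choose m)))"
  proof (intro sum.cong refl)
    fix i
    have "{p. p \<in> X \<times> X \<and> ?g p = i} = self_intersection X i"
      by (auto simp: self_intersection_def)
    moreover have "(\<Sum>p | p \<in> X \<times> X \<and> ?g p = i. ?h p) = (\<Sum>p | p \<in> X \<times> X \<and> ?g p = i.
        falling_ratio (card E) m (2 * k - i) * real (card E choose m))"
      by (intro sum.cong refl) auto
    ultimately show "(\<Sum>p | p \<in> X \<times> X \<and> ?g p = i. ?h p) = real (card (self_intersection X i)) *
      (falling_ratio (card E) m (2 * k - i) * real (card E choose m))"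
      by simp
  qed
  finally show ?thesis by (simp add: sum_distrib_right mult.assoc)
qed

text \<open>Expanding the square gives the second moment minus \<mu>^2. By negative correlation the
  pairs with i = 0 contribute at most \<mu>^2, so only i \<ge> 1 survives.\<close>

lemma tuples_variance_le:
  assumes E: "finite E" and X: "X \<subseteq> distinct_tuples k E" and m: "2 * k \<le> m" "m \<le> card E"
  defines "\<mu> \<equiv> real (card X) * falling_ratio (card E) m k"
  shows "(\<Sum>a | a \<subseteq> E \<and> card a = m. (real (card (distinct_tuples k a \<inter> X)) - \<mu>)\<^sup>2) \<le>
    (\<Sum>i=1..k. real (card (self_intersection X i)) * (real m / real (card E)) ^ (2 * k - i)) *
      real (card E choose m)"
proof -
  let ?C = "real (card E choose m)"
  let ?Z = "\<lambda>a. real (card (distinct_tuples k a \<inter> X))"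
  let ?fr = "falling_ratio (card E) m"
  let ?Y = "\<lambda>i. real (card (self_intersection X i))"
  have fX: "finite X" using X E finite_distinct_tuples finite_subset by blast
  have "(\<Sum>a | a \<subseteq> E \<and> card a = m. (?Z a - \<mu>)\<^sup>2) =
      (\<Sum>a | a \<subseteq> E \<and> card a = m. (?Z a)\<^sup>2 - 2 * \<mu> * ?Z a + \<mu>\<^sup>2)"
    by (intro sum.cong refl) (simp add: power2_diff)
  also have "\<dots> = (\<Sum>a | a \<subseteq> E \<and> card a = m. (?Z a)\<^sup>2) - 2 * \<mu> * (\<mu> * ?C) + ?C * \<mu>\<^sup>2"
    using sum_card_tuples[OF E X _ m(2)] m E
    by (simp add: sum.distrib sum_subtractf n_subsets \<mu>_def flip: sum_distrib_left)
  also have "\<dots> = ((\<Sum>i\<le>k. ?Y i * ?fr (2 * k - i)) - \<mu>\<^sup>2) * ?C"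
    unfolding sum_card_tuples_square[OF E X m] by (simp add: algebra_simps power2_eq_square)
  also have "\<dots> \<le> (\<Sum>i=1..k. ?Y i * (real m / real (card E)) ^ (2 * k - i)) * ?C"
  proof (intro mult_right_mono)
    have "self_intersection X 0 \<subseteq> X \<times> X" by (auto simp: self_intersection_def)
    then have "card (self_intersection X 0) \<le> card (X \<times> X)" using fX by (intro card_mono) auto
    then have "card (self_intersection X 0) \<le> card X ^ 2"
      by (simp add: card_cartesian_product power2_eq_square)
    then have "?Y 0 \<le> (real (card X))\<^sup>2" by (simp flip: of_nat_power)
    then have "?Y 0 * ?fr (2 * k) \<le> (real (card X))\<^sup>2 * (?fr k)\<^sup>2"
      using falling_ratio_double_le[OF m] falling_ratio_pos[of "2*k" m "card E"] m
      by (intro mult_mono) auto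
    then have 0: "?Y 0 * ?fr (2 * k) \<le> \<mu>\<^sup>2" by (simp add: \<mu>_def power_mult_distrib)
    have "(\<Sum>i\<le>k. ?Y i * ?fr (2 * k - i)) = ?Y 0 * ?fr (2 * k) + (\<Sum>i=1..k. ?Y i * ?fr (2 * k - i))"
      by (simp add: sum.atMost_shift sum.atLeast1_atMost_eq lessThan_atLeast0)
    also have "(\<Sum>i=1..k. ?Y i * ?fr (2 * k - i)) \<le>
        (\<Sum>i=1..k. ?Y i * (real m / real (card E)) ^ (2 * k - i))"
      using m by (intro sum_mono mult_left_mono falling_ratio_le_power) auto
    finally show "(\<Sum>i\<le>k. ?Y i * ?fr (2 * k - i)) - \<mu>\<^sup>2 \<le>
        (\<Sum>i=1..k. ?Y i * (real m / real (card E)) ^ (2 * k - i))" using 0 by simp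
  qed simp
  finally show ?thesis .
qed

text \<open>Chebyshev's inequality in counting form, with threshold \<mu>/2. It suffices to know the
  size of Z up to a constant factor, since such a factor disappears in the density.\<close>

lemma card_far_from_mean_le:
  assumes E: "finite E" and X: "X \<subseteq> distinct_tuples k E" and m: "2 * k \<le> m" "m \<le> card E"
    and "0 < m" and "X \<noteq> {}"
  defines "\<mu> \<equiv> real (card X) * falling_ratio (card E) m k"
  shows "real (card {a. a \<subseteq> E \<and> card a = m \<and>
      \<mu> / 2 < \<bar>real (card (distinct_tuples k a \<inter> X)) - \<mu>\<bar>}) \<le>
    4 ^ Suc k * (\<Sum>i=1..k. real (card (self_intersection X i)) * (real (card E) / real m) ^ i) /
      (real (card X))\<^sup>2 * real (card E choose m)" (is "real (card ?B) \<le> _")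
proof -
  let ?C = "real (card E choose m)"
  let ?Z = "\<lambda>a. real (card (distinct_tuples k a \<inter> X))"
  let ?Y = "\<lambda>i. real (card (self_intersection X i))"
  let ?q = "real m / real (card E)"
  have fX: "finite X" using X E finite_distinct_tuples finite_subset by blast
  have N: "0 < card E" and X0: "0 < card X" using m \<open>0 < m\<close> fX \<open>X \<noteq> {}\<close> by auto
  have \<mu>: "0 < \<mu>" using X0 falling_ratio_pos[of k m "card E"] m by (simp add: \<mu>_def)
  have fP: "finite {a. a \<subseteq> E \<and> card a = m}" using E by auto
  have q: "0 < ?q" using N \<open>0 < m\<close> by simp
  have "real (card ?B) * (\<mu> / 2)\<^sup>2 = (\<Sum>a\<in>?B. (\<mu> / 2)\<^sup>2)" by simp
  also have "\<dots> \<le> (\<Sum>a\<in>?B. (?Z a - \<mu>)\<^sup>2)"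
    using \<mu> by (intro sum_mono) (auto simp: power2_abs abs_le_square_iff[symmetric])
  also have "\<dots> \<le> (\<Sum>a | a \<subseteq> E \<and> card a = m. (?Z a - \<mu>)\<^sup>2)"
    using fP by (intro sum_mono2) auto
  also have "\<dots> \<le> (\<Sum>i=1..k. ?Y i * ?q ^ (2 * k - i)) * ?C"
    unfolding \<mu>_def by (rule tuples_variance_le[OF E X m])
  \<comment> \<open>The common factor \<open>?q ^ (2 * k)\<close> is pulled out because \<mu>^2
    carries the same one; what remains are powers of 1/q = N/m.\<close>
  also have "(\<Sum>i=1..k. ?Y i * ?q ^ (2 * k - i)) = (\<Sum>i=1..k. ?Y i * (1 / ?q) ^ i) * (?q ^ k)\<^sup>2"
    unfolding sum_distrib_right
  proof (intro sum.cong refl)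
    fix i assume "i \<in> {1..k}"
    then have "?q ^ (2 * k - i) = ?q ^ (2 * k) / ?q ^ i"
      using N \<open>0 < m\<close> by (intro power_diff) auto
    then show "?Y i * ?q ^ (2 * k - i) = ?Y i * (1 / ?q) ^ i * (?q ^ k)\<^sup>2"
      by (simp add: power_divide power_mult[symmetric] mult.commute)
  qed
  finally have main: "real (card ?B) * (\<mu> / 2)\<^sup>2 \<le> (\<Sum>i=1..k. ?Y i * (1 / ?q) ^ i) * (?q ^ k)\<^sup>2 * ?C" .
  \<comment> \<open>The constant \<open>4 ^ Suc k\<close> arises here: 2^k from this lower bound on
    \<mu> and 2 from the threshold \<mu>/2, both squared.\<close>
  have "real (card X) * (?q / 2) ^ k \<le> \<mu>"
    unfolding \<mu>_def using power_le_falling_ratio[OF m]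
    by (intro mult_left_mono) (simp_all add: mult.commute)
  then have "(real (card X) * (?q / 2) ^ k / 2)\<^sup>2 \<le> (\<mu> / 2)\<^sup>2"
    using q by (intro power_mono) auto
  then have "real (card ?B) * (real (card X) * (?q / 2) ^ k / 2)\<^sup>2 \<le> real (card ?B) * (\<mu> / 2)\<^sup>2"
    by (intro mult_left_mono) auto
  also note main
  also have "(real (card X) * (?q / 2) ^ k / 2)\<^sup>2 = (real (card X))\<^sup>2 * (?q ^ k)\<^sup>2 / 4 ^ Suc k"
  proof -
    have "(4::real) ^ k = 2 ^ k * 2 ^ k" by (simp flip: power_mult_distrib)
    then show ?thesis by (simp add: power_divide power_mult_distrib power2_eq_square mult_ac)
  qed
  finally have "real (card ?B) * (real (card X))\<^sup>2 / 4 ^ Suc k * (?q ^ k)\<^sup>2 \<le>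
      (\<Sum>i=1..k. ?Y i * (1 / ?q) ^ i) * ?C * (?q ^ k)\<^sup>2"
    by (simp add: algebra_simps)
  then have "real (card ?B) * (real (card X))\<^sup>2 / 4 ^ Suc k \<le> (\<Sum>i=1..k. ?Y i * (1 / ?q) ^ i) * ?C"
    by (rule mult_right_le_imp_le) (use N \<open>0 < m\<close> in simp)
  then show ?thesis using X0 by (simp add: field_simps)
qed

section \<open>Weak limits and permutation invariance\<close>

lemma measurable_random_subset:
  "random_subset M E A \<Longrightarrow> A \<in> M \<rightarrow>\<^sub>M count_space (Pow E)"
  by (simp add: random_subset_def)

lemma random_subset_sets:
  assumes "random_subset M E A"
  shows "{\<omega> \<in> space M. P (A \<omega>)} \<in> sets M"
  by (rule measurable_sets_Collect[OF measurable_random_subset[OF assms]])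
     auto

lemma measurable_dens:
  assumes "random_subset M E A"
  shows "(\<lambda>\<omega>. dens E (A \<omega>)) \<in> borel_measurable M"
  by (rule measurable_compose[OF measurable_random_subset[OF assms]]) simp

section \<open>Convergence in distribution to a constant\<close>

text \<open>Convergence in probability to a constant implies weak convergence: f is within e/2 of
  f(c) on a neighbourhood of c, and off it the difference is at most 2B on an event of vanishing
  probability.\<close>

lemma weakly_converges_return:
  fixes X :: "nat \<Rightarrow> 'w \<Rightarrow> 'c::topological_space"
  assumes M: "\<And>n. prob_space (M n)"
    and X: "\<And>n. X n \<in> borel_measurable (M n)"
    and lim: "\<And>U. open U \<Longrightarrow> c \<in> U \<Longrightarrow>
      (\<lambda>n. measure (M n) {\<omega> \<in> space (M n). X n \<omega> \<notin> U}) \<longlonglongrightarrow> 0"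
  shows "weakly_converges (\<lambda>n. distr (M n) borel (X n)) (return borel c)"
  unfolding weakly_converges_def
proof (intro allI impI)
  fix f :: "'c \<Rightarrow> real"
  assume f: "continuous_on UNIV f" and "bounded (range f)"
  then obtain B where B: "\<And>x. \<bar>f x\<bar> \<le> B" by (auto simp: bounded_iff)
  have fm: "f \<in> borel_measurable borel" by (rule borel_measurable_continuous_onI[OF f])
  have "0 \<le> B" using B[of c] by linarith
  have "(\<lambda>n. integral\<^sup>L (M n) (\<lambda>\<omega>. f (X n \<omega>))) \<longlonglongrightarrow> f c"
  proof (rule tendstoI)
    fix e :: real assume e: "0 < e"
    let ?U = "{x. \<bar>f x - f c\<bar> < e / 2}"
    have "open ?U"
      by (intro open_Collect_less continuous_intros f)
    moreover have "c \<in> ?U" using e by simp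
    ultimately have "(\<lambda>n. e / 2 + 2 * B * measure (M n) {\<omega> \<in> space (M n). X n \<omega> \<notin> ?U}) \<longlonglongrightarrow> e / 2 + 2 * B * 0"
      by (intro tendsto_intros lim)
    then have "\<forall>\<^sub>F n in sequentially. e / 2 + 2 * B * measure (M n) {\<omega> \<in> space (M n). X n \<omega> \<notin> ?U} < e"
      by (rule order_tendstoD(2)) (use e in simp)
    then show "\<forall>\<^sub>F n in sequentially. dist (integral\<^sup>L (M n) (\<lambda>\<omega>. f (X n \<omega>))) (f c) < e"
    proof eventually_elim
      case (elim n)
      interpret prob_space "M n" by (rule M)
      note [measurable] = X[of n] fm
      define V where "V = {\<omega> \<in> space (M n). X n \<omega> \<notin> ?U}"
      have V: "V \<in> sets (M n)" unfolding V_def by measurable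
      have int: "integrable (M n) (\<lambda>\<omega>. f (X n \<omega>))"
        by (rule integrable_const_bound[where B = B]) (use B in auto)
      have intV: "integrable (M n) (\<lambda>\<omega>. 2 * B * indicator V \<omega>)"
        using V by (intro integrable_mult_right integrable_real_indicator) (auto simp: less_top[symmetric])
      have "\<bar>expectation (\<lambda>\<omega>. f (X n \<omega>)) - f c\<bar> = \<bar>expectation (\<lambda>\<omega>. f (X n \<omega>) - f c)\<bar>"
        using int by (simp add: prob_space)
      also have "\<dots> \<le> expectation (\<lambda>\<omega>. \<bar>f (X n \<omega>) - f c\<bar>)" by (rule integral_abs_bound)
      also have "\<dots> \<le> expectation (\<lambda>\<omega>. e / 2 + 2 * B * indicator V \<omega>)"
      proof (rule integral_mono)
        fix \<omega> assume "\<omega> \<in> space (M n)"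
        then show "\<bar>f (X n \<omega>) - f c\<bar> \<le> e / 2 + 2 * B * indicator V \<omega>"
          using B[of "X n \<omega>"] B[of c] e by (cases "\<omega> \<in> V") (auto simp: V_def)
      qed (use int intV in auto)
      also have "\<dots> = e / 2 + 2 * B * prob V"
        using V intV by (subst Bochner_Integration.integral_add) (auto simp: prob_space)
      finally show ?case using elim by (simp add: dist_real_def V_def)
    qed
  qed
  moreover have "integral\<^sup>L (return borel c) f = f c"
    using fm by (simp add: integral_return)
  moreover have "integral\<^sup>L (distr (M n) borel (X n)) f = integral\<^sup>L (M n) (\<lambda>\<omega>. f (X n \<omega>))" for n
    by (rule integral_distr[OF X fm])
  ultimately show "(\<lambda>n. integral\<^sup>L (distr (M n) borel (X n)) f) \<longlonglongrightarrow> integral\<^sup>L (return borel c) f"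
    by simp
qed

text \<open>The converse direction at a finite constant: weak convergence is tested on the truncated
  distance min(|x - c|, e), and Markov's inequality bounds the probability that it reaches
  e.\<close>

lemma weakly_converges_ereal_deviation:
  fixes X :: "nat \<Rightarrow> 'w \<Rightarrow> ereal" and c e :: real
  assumes M: "\<And>n. prob_space (M n)"
    and X: "\<And>n. X n \<in> borel_measurable (M n)"
    and w: "weakly_converges (\<lambda>n. distr (M n) borel (X n)) (return borel (ereal c))"
    and e: "0 < e"
  shows "(\<lambda>n. measure (M n) {\<omega> \<in> space (M n). X n \<omega> \<notin> {ereal (c - e)<..<ereal (c + e)}}) \<longlonglongrightarrow> 0"
proof -
  \<comment> \<open>Clipping to [c - e, c + e] comes before \<open>real_of_ereal\<close>, which
    sends the infinite values to 0 and is not continuous there.\<close>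
  define clip :: "ereal \<Rightarrow> ereal" where "clip x = max (ereal (c - e)) (min (ereal (c + e)) x)" for x
  define f where "f x = \<bar>real_of_ereal (clip x) - c\<bar>" for x
  have fin: "clip x \<noteq> \<infinity>" "clip x \<noteq> -\<infinity>" for x by (cases x) (auto simp: clip_def max_def min_def)
  have "continuous_on UNIV clip" unfolding clip_def by (intro continuous_intros)
  then have "continuous_on UNIV (\<lambda>x. real_of_ereal (clip x))"
    using fin by (intro continuous_on_compose2[OF continuous_on_real]) auto
  then have f: "continuous_on UNIV f" unfolding f_def by (intro continuous_intros)
  have f_eq: "f x = (if x \<in> {ereal (c - e)<..<ereal (c + e)} then \<bar>real_of_ereal x - c\<bar> else e)" for x
    using e by (cases x) (auto simp: f_def clip_def max_def min_def)
  have fb: "0 \<le> f x \<and> f x \<le> e" for x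
    using e by (cases x) (auto simp: f_eq)
  have "bounded (range f)" using fb by (intro boundedI[where B = e]) auto
  with f w have "(\<lambda>n. integral\<^sup>L (distr (M n) borel (X n)) f) \<longlonglongrightarrow> integral\<^sup>L (return borel (ereal c)) f"
    by (auto simp: weakly_converges_def)
  moreover have fm: "f \<in> borel_measurable borel" by (rule borel_measurable_continuous_onI[OF f])
  moreover have "integral\<^sup>L (distr (M n) borel (X n)) f = integral\<^sup>L (M n) (\<lambda>\<omega>. f (X n \<omega>))" for n
    by (rule integral_distr[OF X fm])
  ultimately have "(\<lambda>n. integral\<^sup>L (M n) (\<lambda>\<omega>. f (X n \<omega>))) \<longlonglongrightarrow> 0"
    using e by (simp add: integral_return f_eq)
  then have lim: "(\<lambda>n. integral\<^sup>L (M n) (\<lambda>\<omega>. f (X n \<omega>)) / e) \<longlonglongrightarrow> 0"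
    using tendsto_divide[OF _ tendsto_const[of e]] e by fastforce
  show ?thesis
  proof (rule tendsto_sandwich[OF _ _ tendsto_const lim])
    show "\<forall>\<^sub>F n in sequentially. measure (M n) {\<omega> \<in> space (M n). X n \<omega> \<notin> {ereal (c - e)<..<ereal (c + e)}}
        \<le> integral\<^sup>L (M n) (\<lambda>\<omega>. f (X n \<omega>)) / e"
    proof (intro always_eventually allI)
      fix n
      interpret prob_space "M n" by (rule M)
      note [measurable] = X[of n] fm
      have int: "integrable (M n) (\<lambda>\<omega>. f (X n \<omega>))"
        by (rule integrable_const_bound[where B = e]) (use fb in auto)
      have "prob {\<omega> \<in> space (M n). X n \<omega> \<notin> {ereal (c - e)<..<ereal (c + e)}} \<le>
          prob {\<omega> \<in> space (M n). e \<le> f (X n \<omega>)}"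
      proof (intro finite_measure_mono)
        show "{\<omega> \<in> space (M n). X n \<omega> \<notin> {ereal (c - e)<..<ereal (c + e)}} \<subseteq> {\<omega> \<in> space (M n). e \<le> f (X n \<omega>)}"
          by (auto simp: f_eq)
      qed measurable
      also have "\<dots> \<le> expectation (\<lambda>\<omega>. f (X n \<omega>)) / e"
        using fb e by (intro integral_Markov_inequality_measure[OF int, where A = "{}"]) auto
      finally show "prob {\<omega> \<in> space (M n). X n \<omega> \<notin> {ereal (c - e)<..<ereal (c + e)}} \<le>
        expectation (\<lambda>\<omega>. f (X n \<omega>)) / e" .
    qed
  qed auto
qed

text \<open>A permutation invariant random subset is uniform once its cardinality is fixed.\<close>

lemma permutation_invariant_prob_le:
  assumes R: "random_subset M E A" and inv: "permutation_invariant M E A" and E: "finite E"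
    and "0 \<le> \<delta>"
    and bad: "\<And>m. m \<in> I \<Longrightarrow> m \<le> card E \<Longrightarrow> real (card {a. a \<subseteq> E \<and> card a = m \<and> B a}) \<le> \<delta> * real (card E choose m)"
  shows "measure M {\<omega> \<in> space M. B (A \<omega>)} \<le> measure M {\<omega> \<in> space M. card (A \<omega>) \<notin> I} + \<delta>"
proof -
  interpret prob_space M using R by (simp add: random_subset_def)
  note S = random_subset_sets[OF R]
  have AE: "A \<omega> \<subseteq> E" if "\<omega> \<in> space M" for \<omega>
    using measurable_space[OF measurable_random_subset[OF R] that] by auto
  define q where "q a = prob {\<omega> \<in> space M. A \<omega> = a}" for a
  have q0: "0 \<le> q a" for a by (simp add: q_def)
  \<comment> \<open>Invariance is applied to a permutation carrying a to b, glued from a bijection a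
    -> b and a bijection of the complements in E.\<close>
  have q_eq: "q a = q b" if ab: "a \<subseteq> E" "b \<subseteq> E" "card a = card b" for a b
  proof -
    have fin: "finite a" "finite b" using ab E finite_subset by blast+
    then obtain f where f: "bij_betw f a b" using ab by (metis bij_betw_iff_card)
    have "card (E - a) = card (E - b)" using ab fin by (simp add: card_Diff_subset)
    then obtain g where g: "bij_betw g (E - a) (E - b)" using E by (metis bij_betw_iff_card finite_Diff)
    define s where "s x = (if x \<in> a then f x else if x \<in> E then g x else x)" for x
    have sa: "bij_betw s a b" using f by (subst bij_betw_cong[of a s f]) (auto simp: s_def)
    have "bij_betw s (E - a) (E - b)" using g by (subst bij_betw_cong[of _ s g]) (auto simp: s_def)
    then have "bij_betw s (a \<union> (E - a)) (b \<union> (E - b))"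
      using sa by (intro bij_betw_combine) auto
    then have "bij_betw s E E" using ab by (simp add: Un_absorb1)
    then have "s permutes E" by (rule bij_imp_permutes) (use ab in \<open>auto simp: s_def\<close>)
    moreover have "s ` a = b" using sa by (simp add: bij_betw_def)
    ultimately show ?thesis using inv ab(1) unfolding permutation_invariant_def q_def by blast
  qed
  have prob_eq: "prob {\<omega> \<in> space M. P (A \<omega>)} = (\<Sum>a | a \<subseteq> E \<and> P a. q a)" for P
  proof -
    have "{\<omega> \<in> space M. P (A \<omega>)} = (\<Union>a\<in>{a. a \<subseteq> E \<and> P a}. {\<omega> \<in> space M. A \<omega> = a})"
      using AE by auto
    then show ?thesis unfolding q_def using E S[of "\<lambda>x. x = _"]
      by (simp, intro finite_measure_finite_Union) (auto simp: disjoint_family_on_def)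
  qed
  have split: "(\<Sum>a | a \<subseteq> E \<and> card a \<in> I \<and> P a. q a) =
      (\<Sum>m\<in>I \<inter> {..card E}. \<Sum>a | a \<subseteq> E \<and> card a = m \<and> P a. q a)" for P
  proof -
    have "(\<Sum>a | a \<subseteq> E \<and> card a \<in> I \<and> P a. q a) =
        (\<Sum>m\<in>I \<inter> {..card E}. sum q {a \<in> {a. a \<subseteq> E \<and> card a \<in> I \<and> P a}. card a = m})"
      using E by (intro sum.group[symmetric]) (auto intro: card_mono)
    also have "\<dots> = (\<Sum>m\<in>I \<inter> {..card E}. \<Sum>a | a \<subseteq> E \<and> card a = m \<and> P a. q a)"
      by (intro sum.cong refl) auto
    finally show ?thesis .
  qed
  \<comment> \<open>The dummy conjunct \<open>True\<close> makes the right-hand side an instance of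
    \<open>split\<close> too, so that it sums back to the probability of a size in I.\<close>
  have "(\<Sum>a | a \<subseteq> E \<and> card a \<in> I \<and> B a. q a) \<le> (\<Sum>m\<in>I \<inter> {..card E}. \<delta> * (\<Sum>a | a \<subseteq> E \<and> card a = m \<and> True. q a))"
    unfolding split
  proof (intro sum_mono)
    fix m assume m: "m \<in> I \<inter> {..card E}"
    \<comment> \<open>All m-sets have the weight of one representative b, which turns the counting
      hypothesis \<open>bad\<close> into a bound on probabilities.\<close>
    obtain b where b: "b \<subseteq> E" "card b = m" using m by (metis IntE atMost_iff obtain_subset_with_card_n)
    have "(\<Sum>a | a \<subseteq> E \<and> card a = m \<and> B a. q a) = (\<Sum>a | a \<subseteq> E \<and> card a = m \<and> B a. q b)"
      using b by (intro sum.cong refl q_eq) auto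
    also have "\<dots> = real (card {a. a \<subseteq> E \<and> card a = m \<and> B a}) * q b" by simp
    also have "\<dots> \<le> \<delta> * real (card E choose m) * q b"
      using bad m q0 by (intro mult_right_mono) auto
    also have "\<dots> = \<delta> * (\<Sum>a | a \<subseteq> E \<and> card a = m \<and> True. q b)"
      using E by (simp add: n_subsets)
    also have "(\<Sum>a | a \<subseteq> E \<and> card a = m \<and> True. q b) = (\<Sum>a | a \<subseteq> E \<and> card a = m \<and> True. q a)"
      using b by (intro sum.cong refl q_eq) auto
    finally show "(\<Sum>a | a \<subseteq> E \<and> card a = m \<and> B a. q a) \<le> \<delta> * (\<Sum>a | a \<subseteq> E \<and> card a = m \<and> True. q a)" .
  qed
  also have "\<dots> = \<delta> * (\<Sum>a | a \<subseteq> E \<and> card a \<in> I \<and> True. q a)"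
    unfolding split by (simp add: sum_distrib_left)
  also have "\<dots> \<le> \<delta> * 1"
    unfolding prob_eq[of "\<lambda>a. card a \<in> I \<and> True", symmetric] using \<open>0 \<le> \<delta>\<close> by (intro mult_left_mono) auto
  finally have le: "prob {\<omega> \<in> space M. card (A \<omega>) \<in> I \<and> B (A \<omega>)} \<le> \<delta>"
    by (simp add: prob_eq[of "\<lambda>a. card a \<in> I \<and> B a"])
  have "prob {\<omega> \<in> space M. B (A \<omega>)} \<le>
      prob ({\<omega> \<in> space M. card (A \<omega>) \<notin> I} \<union> {\<omega> \<in> space M. card (A \<omega>) \<in> I \<and> B (A \<omega>)})"
    by (intro finite_measure_mono sets.Un S) auto
  also have "\<dots> \<le> prob {\<omega> \<in> space M. card (A \<omega>) \<notin> I} + prob {\<omega> \<in> space M. card (A \<omega>) \<in> I \<and> B (A \<omega>)}"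
    by (intro measure_Un_le S)
  finally show ?thesis using le by simp
qed

section \<open>Asymptotic sizes\<close>

lemma card_distinct_tuples_le:
  assumes "finite S" shows "card (distinct_tuples k S) \<le> card S ^ k"
proof -
  have "card (distinct_tuples k S) \<le> card {xs. set xs \<subseteq> S \<and> length xs = k}"
    by (intro card_mono finite_lists_length_eq assms) (auto simp: distinct_tuples_def)
  then show ?thesis by (simp add: card_lists_length_eq assms)
qed

lemma card_distinct_tuples_ge:
  assumes "finite S" "2 * k \<le> card S"
  shows "(real (card S) / 2) ^ k \<le> real (card (distinct_tuples k S))"
proof -
  have "distinct_tuples k S = {xs. length xs = k \<and> distinct xs \<and> set xs \<subseteq> S}"
    by (auto simp: distinct_tuples_def)
  then have eq: "card (distinct_tuples k S) = \<Prod>{card S - k + 1..card S}"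
    using card_lists_distinct_length_eq[of S k] assms by simp
  have "(\<Prod>i\<in>{card S - k + 1..card S}. real (card S) / 2) \<le> (\<Prod>i\<in>{card S - k + 1..card S}. real i)"
    using assms by (intro prod_mono) auto
  then show ?thesis using assms by (simp add: eq)
qed

text \<open>Sharing k elements forces both tuples to have the same underlying set, so y is one of
  the k^k words over the elements of x. The crude count k^k, rather than k!, is a constant and
  suffices.\<close>

lemma card_self_intersection_top_le:
  assumes "X \<subseteq> distinct_tuples k E" "finite E"
  shows "card (self_intersection X k) \<le> k ^ k * card X"
proof -
  have fX: "finite X" using assms finite_distinct_tuples finite_subset by blast
  have XD: "finite (set x)" "length x = k" "card (set x) = k" if "x \<in> X" for x
    using that assms(1) by (auto simp: distinct_tuples_def distinct_card)
  have "self_intersection X k \<subseteq> (SIGMA x:X. {y. set y \<subseteq> set x \<and> length y = k})"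
  proof
    fix p assume "p \<in> self_intersection X k"
    then obtain x y where p: "p = (x, y)" "x \<in> X" "y \<in> X" "card (set x \<inter> set y) = k"
      by (auto simp: self_intersection_def)
    then have "set x \<inter> set y = set y" using XD by (intro card_subset_eq) auto
    then show "p \<in> (SIGMA x:X. {y. set y \<subseteq> set x \<and> length y = k})" using p XD by auto
  qed
  then have "card (self_intersection X k) \<le> card (SIGMA x:X. {y. set y \<subseteq> set x \<and> length y = k})"
    using fX by (intro card_mono finite_SigmaI finite_lists_length_eq) auto
  also have "\<dots> = (\<Sum>x\<in>X. card {y. set y \<subseteq> set x \<and> length y = k})"
    using fX by (intro card_SigmaI) (auto intro: finite_lists_length_eq)
  also have "\<dots> = (\<Sum>x\<in>X. k ^ k)"
    using XD by (intro sum.cong refl) (simp add: card_lists_length_eq)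
  finally show ?thesis by (simp add: mult.commute)
qed

lemma random_subset_tuples:
  assumes R: "random_subset M E A" and X: "X \<subseteq> distinct_tuples k E"
  shows "random_subset M (distinct_tuples k E) (\<lambda>\<omega>. distinct_tuples k (A \<omega>) \<inter> X)"
proof -
  have "(\<lambda>a. distinct_tuples k a \<inter> X) \<in> count_space (Pow E) \<rightarrow>\<^sub>M count_space (Pow (distinct_tuples k E))"
    using X by auto
  then show ?thesis
    using R measurable_compose[OF measurable_random_subset[OF R]] unfolding random_subset_def by blast
qed

text \<open>Densities of tuple sets use the base |E^(k)|, whereas the moment bounds are powers of
  |E|; this limit converts between them. It follows by squeezing |E^(k)| between (|E|/2)^k and
  |E|^k.\<close>

lemma ln_card_distinct_tuples_ratio:
  assumes E: "\<And>n. finite (E n)" and lim: "filterlim (\<lambda>n. card (E n)) at_top sequentially"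
  shows "(\<lambda>n. ln (real (card (distinct_tuples k (E n)))) / ln (real (card (E n)))) \<longlonglongrightarrow> real k"
proof -
  have "filterlim (\<lambda>n. ln (real (card (E n)))) at_top sequentially"
    by (intro filterlim_compose[OF ln_at_top] filterlim_compose[OF filterlim_real_sequentially lim])
  then have "(\<lambda>n. inverse (ln (real (card (E n))))) \<longlonglongrightarrow> 0"
    by (rule tendsto_inverse_0_at_top)
  then have "(\<lambda>n. real k - real k * ln 2 * inverse (ln (real (card (E n))))) \<longlonglongrightarrow> real k - real k * ln 2 * 0"
    by (intro tendsto_intros)
  then have low: "(\<lambda>n. real k - real k * ln 2 * inverse (ln (real (card (E n))))) \<longlonglongrightarrow> real k" by simp
  have ev: "\<forall>\<^sub>F n in sequentially. max 2 (2 * k) \<le> card (E n)"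
    using lim unfolding filterlim_at_top by blast
  show ?thesis
  proof (rule tendsto_sandwich[OF _ _ low tendsto_const])
    show "\<forall>\<^sub>F n in sequentially. real k - real k * ln 2 * inverse (ln (real (card (E n)))) \<le>
        ln (real (card (distinct_tuples k (E n)))) / ln (real (card (E n)))"
      using ev
    proof eventually_elim
      case (elim n)
      then have N: "2 \<le> real (card (E n))" by linarith
      then have L: "0 < ln (real (card (E n)))" by simp
      have "0 < (real (card (E n)) / 2) ^ k" using N by simp
      then have "ln ((real (card (E n)) / 2) ^ k) \<le> ln (real (card (distinct_tuples k (E n))))"
        using card_distinct_tuples_ge[OF E, of k n] elim by (subst ln_le_cancel_iff) linarith+
      then have "real k * (ln (real (card (E n))) - ln 2) \<le> ln (real (card (distinct_tuples k (E n))))"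
        using N by (simp add: ln_realpow ln_div)
      then have "real k * (ln (real (card (E n))) - ln 2) / ln (real (card (E n))) \<le>
          ln (real (card (distinct_tuples k (E n)))) / ln (real (card (E n)))"
        using L by (intro divide_right_mono) auto
      moreover have "real k * (ln (real (card (E n))) - ln 2) / ln (real (card (E n))) =
          real k - real k * ln 2 * inverse (ln (real (card (E n))))"
        using L by (simp add: field_simps)
      ultimately show ?case by simp
    qed
    show "\<forall>\<^sub>F n in sequentially. ln (real (card (distinct_tuples k (E n)))) / ln (real (card (E n))) \<le> real k"
      using ev
    proof eventually_elim
      case (elim n)
      then have N: "2 \<le> real (card (E n))" by linarith
      then have L: "0 < ln (real (card (E n)))" by simp
      have "0 < (real (card (E n)) / 2) ^ k" using N by simp
      then have "0 < real (card (distinct_tuples k (E n)))"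
        using card_distinct_tuples_ge[OF E, of k n] elim by linarith
      moreover have "real (card (distinct_tuples k (E n))) \<le> real (card (E n)) ^ k"
        using card_distinct_tuples_le[OF E, of k n] by (metis of_nat_le_iff of_nat_power)
      ultimately have "ln (real (card (distinct_tuples k (E n)))) \<le> ln (real (card (E n)) ^ k)"
        by (subst ln_le_cancel_iff) linarith+
      then show ?case using L N by (simp add: ln_realpow field_simps)
    qed
  qed
qed

section \<open>From densities to cardinalities\<close>

text \<open>Allowing any b above |F| as base lets |E|^k replace the exact number of tuples.\<close>

lemma card_le_powr_of_dens_less:
  assumes "dens F a < ereal r" "finite a" "1 < card F" "real (card F) \<le> b"
  shows "real (card a) \<le> b powr r"
proof (cases "a = {}")
  case False
  then have a: "1 \<le> real (card a)" using assms(2) by (simp add: Suc_le_eq card_gt_0_iff)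
  then have *: "log (real (card F)) (real (card a)) < r" using assms False by (simp add: dens_def)
  then have "real (card a) < real (card F) powr r" using assms a by (simp add: log_less_iff)
  \<comment> \<open>A nonempty set has density at least 0, so r is positive and the power is
    monotone in its base. For the empty set the sign of r does not matter.\<close>
  moreover have "0 \<le> log (real (card F)) (real (card a))" using assms a by simp
  then have "real (card F) powr r \<le> b powr r"
    using assms * by (intro powr_mono2) auto
  ultimately show ?thesis by linarith
qed simp

text \<open>The clause \<open>0 < m\<close> rules out the empty set: its density is
  \<open>-\<infinity>\<close>, but \<open>log\<close> of 0 returns 0, which may lie within
  \<epsilon> of d.\<close>

lemma random_densable_card_concentration:
  assumes R: "random_densable M E A (ereal d)" and E: "\<And>n. finite (E n)" and "0 < \<epsilon>"
  shows "(\<lambda>n. measure (M n) {\<omega> \<in> space (M n).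
      card (A n \<omega>) \<notin> {m. 0 < m \<and> \<bar>log (real (card (E n))) (real m) - d\<bar> < \<epsilon>}}) \<longlonglongrightarrow> 0"
proof -
  have rs: "random_subset (M n) (E n) (A n)" for n using R by (simp add: random_densable_def)
  have "(\<lambda>n. measure (M n) {\<omega> \<in> space (M n). dens (E n) (A n \<omega>) \<notin> {ereal (d - \<epsilon>)<..<ereal (d + \<epsilon>)}}) \<longlonglongrightarrow> 0"
    using R rs \<open>0 < \<epsilon>\<close>
    by (intro weakly_converges_ereal_deviation measurable_dens)
       (auto simp: random_densable_def random_subset_def)
  also have "(\<lambda>n. measure (M n) {\<omega> \<in> space (M n). dens (E n) (A n \<omega>) \<notin> {ereal (d - \<epsilon>)<..<ereal (d + \<epsilon>)}}) =
    (\<lambda>n. measure (M n) {\<omega> \<in> space (M n).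
      card (A n \<omega>) \<notin> {m. 0 < m \<and> \<bar>log (real (card (E n))) (real m) - d\<bar> < \<epsilon>}})"
  proof (intro ext arg_cong2[where f = measure] refl Collect_cong conj_cong)
    fix n \<omega> assume "\<omega> \<in> space (M n)"
    then have "finite (A n \<omega>)"
      using measurable_space[OF measurable_random_subset[OF rs]] E finite_subset by fastforce
    then show "(dens (E n) (A n \<omega>) \<notin> {ereal (d - \<epsilon>)<..<ereal (d + \<epsilon>)}) =
      (card (A n \<omega>) \<notin> {m. 0 < m \<and> \<bar>log (real (card (E n))) (real m) - d\<bar> < \<epsilon>})"
      by (auto simp: dens_def card_gt_0_iff abs_less_iff)
  qed
  finally show ?thesis .
qed

text \<open>Reduces both parts of the theorem to counting: off an event of vanishing probability,
  |A| is |E|^(d \<plusminus> \<epsilon>), and for each such size the proportion of bad sets is at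
  most \<delta>.\<close>

lemma bad_event_tendsto_0:
  assumes R: "random_densable M E A (ereal d)" and E: "\<And>n. finite (E n)"
    and inv: "\<And>n. permutation_invariant (M n) (E n) (A n)"
    and "0 < \<epsilon>" and \<delta>: "\<delta> \<longlonglongrightarrow> 0"
    and bad: "\<forall>\<^sub>F n in sequentially. 0 \<le> \<delta> n \<and>
      (\<forall>m. 0 < m \<longrightarrow> m \<le> card (E n) \<longrightarrow> \<bar>log (real (card (E n))) (real m) - d\<bar> < \<epsilon> \<longrightarrow>
        real (card {a. a \<subseteq> E n \<and> card a = m \<and> B n a}) \<le> \<delta> n * real (card (E n) choose m))"
  shows "(\<lambda>n. measure (M n) {\<omega> \<in> space (M n). B n (A n \<omega>)}) \<longlonglongrightarrow> 0"
proof -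
  have "(\<lambda>n. measure (M n) {\<omega> \<in> space (M n).
      card (A n \<omega>) \<notin> {m. 0 < m \<and> \<bar>log (real (card (E n))) (real m) - d\<bar> < \<epsilon>}} + \<delta> n) \<longlonglongrightarrow> 0 + 0"
    by (intro tendsto_add random_densable_card_concentration R E \<open>0 < \<epsilon>\<close> \<delta>)
  then have lim: "(\<lambda>n. measure (M n) {\<omega> \<in> space (M n).
      card (A n \<omega>) \<notin> {m. 0 < m \<and> \<bar>log (real (card (E n))) (real m) - d\<bar> < \<epsilon>}} + \<delta> n) \<longlonglongrightarrow> 0" by simp
  show ?thesis
  proof (rule tendsto_sandwich[OF _ _ tendsto_const lim])
    show "\<forall>\<^sub>F n in sequentially. measure (M n) {\<omega> \<in> space (M n). B n (A n \<omega>)} \<le>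
      measure (M n) {\<omega> \<in> space (M n).
        card (A n \<omega>) \<notin> {m. 0 < m \<and> \<bar>log (real (card (E n))) (real m) - d\<bar> < \<epsilon>}} + \<delta> n"
      using bad
    proof eventually_elim
      case (elim n)
      show ?case
        by (rule permutation_invariant_prob_le[OF _ inv E])
           (use R elim in \<open>auto simp: random_densable_def\<close>)
    qed
  qed simp
qed

section \<open>First and second moment arguments\<close>

text \<open>Markov's inequality: the proportion of m-sets with Z \<ge> 1 is at most the mean of Z,
  which is bounded by |X| (m/N)^k.\<close>

lemma tuples_first_moment:
  assumes k: "k \<ge> 1" and E: "\<And>n. finite (E n)"
    and N: "filterlim (\<lambda>n. card (E n)) at_top sequentially"
    and R: "random_densable M E A (ereal d)"
    and inv: "\<And>n. permutation_invariant (M n) (E n) (A n)"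
    and X: "densable (\<lambda>n. distinct_tuples k (E n)) X \<alpha>"
    and less: "ereal d + \<alpha> < 1"
  shows "asymptotically_almost_surely M (\<lambda>n \<omega>. distinct_tuples k (A n \<omega>) \<inter> X n = {})"
proof -
  have rs: "random_subset (M n) (E n) (A n)" for n using R by (simp add: random_densable_def)
  have XT: "X n \<subseteq> distinct_tuples k (E n)" for n using X by (simp add: densable_def)
  have fX: "finite (X n)" for n using XT E finite_distinct_tuples finite_subset by blast
  \<comment> \<open>Since \<alpha> may be \<open>-\<infinity>\<close>, a real r above it serves as
    exponent. Taking \<epsilon> as half of the gap 1 - d - r leaves the total exponent k(r + d +
    \<epsilon> - 1) = -k\<epsilon>, hence the choice of \<delta>.\<close>
  have "\<alpha> < ereal (1 - d)" using less by (cases \<alpha>) (auto simp: one_ereal_def)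
  then obtain r where r: "\<alpha> < ereal r" "ereal r < ereal (1 - d)" using ereal_dense2 by blast
  define \<epsilon> where "\<epsilon> = (1 - d - r) / 2"
  have \<epsilon>: "0 < \<epsilon>" using r by (simp add: \<epsilon>_def)
  define b where "b n = real (card (E n))" for n
  have bt: "filterlim b at_top sequentially"
    unfolding b_def by (intro filterlim_compose[OF filterlim_real_sequentially N])
  define \<delta> where "\<delta> n = b n powr - (real k * \<epsilon>)" for n
  have \<delta>: "\<delta> \<longlonglongrightarrow> 0"
    unfolding \<delta>_def using k \<epsilon> by (intro tendsto_neg_powr bt) auto
  have "(\<lambda>n. dens (distinct_tuples k (E n)) (X n)) \<longlonglongrightarrow> \<alpha>" using X by (simp add: densable_def)
  then have evX: "\<forall>\<^sub>F n in sequentially. dens (distinct_tuples k (E n)) (X n) < ereal r"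
    using r by (intro order_tendstoD(2)) auto
  have evN: "\<forall>\<^sub>F n in sequentially. max 4 (2 * k) \<le> card (E n)" using N unfolding filterlim_at_top by blast
  have "(\<lambda>n. measure (M n) {\<omega> \<in> space (M n). distinct_tuples k (A n \<omega>) \<inter> X n \<noteq> {}}) \<longlonglongrightarrow> 0"
  proof (rule bad_event_tendsto_0[OF R E inv \<epsilon> \<delta>])
    show "\<forall>\<^sub>F n in sequentially. 0 \<le> \<delta> n \<and>
      (\<forall>m. 0 < m \<longrightarrow> m \<le> card (E n) \<longrightarrow> \<bar>log (real (card (E n))) (real m) - d\<bar> < \<epsilon> \<longrightarrow>
        real (card {a. a \<subseteq> E n \<and> card a = m \<and> distinct_tuples k a \<inter> X n \<noteq> {}}) \<le> \<delta> n * real (card (E n) choose m))"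
      using evX evN
    proof eventually_elim
      case (elim n)
      let ?Z = "\<lambda>a. real (card (distinct_tuples k a \<inter> X n))"
      have b: "4 \<le> b n" using elim by (simp add: b_def)
      \<comment> \<open>With |E| \<ge> 4 and k \<ge> 1 there are at least two tuples, so the base of
        the logarithm in the density exceeds 1.\<close>
      have "2 ^ 1 \<le> (b n / 2) ^ 1" using b by simp
      also have "\<dots> \<le> (b n / 2) ^ k" using b k by (intro power_increasing) auto
      also have "\<dots> \<le> real (card (distinct_tuples k (E n)))"
        using card_distinct_tuples_ge[OF E, of k n] elim by (simp add: b_def)
      finally have T: "1 < card (distinct_tuples k (E n))" by simp
      have "real (card (distinct_tuples k (E n))) \<le> b n ^ k"
        using card_distinct_tuples_le[OF E, of k n] unfolding b_def by (metis of_nat_le_iff of_nat_power)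
      then have cX: "real (card (X n)) \<le> (b n ^ k) powr r"
        by (intro card_le_powr_of_dens_less[OF elim(1) fX T])
      have "real (card {a. a \<subseteq> E n \<and> card a = m \<and> distinct_tuples k a \<inter> X n \<noteq> {}}) \<le> \<delta> n * real (card (E n) choose m)"
        if m: "0 < m" "m \<le> card (E n)" "\<bar>log (b n) (real m) - d\<bar> < \<epsilon>" for m
      proof (cases "k \<le> m")
        case True
        let ?P = "{a. a \<subseteq> E n \<and> card a = m}"
        have fP: "finite ?P" using E by auto
        have "real (card {a. a \<subseteq> E n \<and> card a = m \<and> distinct_tuples k a \<inter> X n \<noteq> {}}) =
            (\<Sum>a | a \<subseteq> E n \<and> card a = m \<and> distinct_tuples k a \<inter> X n \<noteq> {}. 1)" by simp
        also have "\<dots> \<le> (\<Sum>a | a \<subseteq> E n \<and> card a = m \<and> distinct_tuples k a \<inter> X n \<noteq> {}. ?Z a)"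
          using fX by (intro sum_mono) (auto simp: Suc_le_eq card_gt_0_iff)
        also have "\<dots> \<le> (\<Sum>a\<in>?P. ?Z a)" using fP by (intro sum_mono2) auto
        also have "\<dots> = real (card (X n)) * falling_ratio (card (E n)) m k * real (card (E n) choose m)"
          by (rule sum_card_tuples[OF E XT True m(2)])
        also have "\<dots> \<le> \<delta> n * real (card (E n) choose m)"
        proof (intro mult_right_mono)
          have "real m = b n powr log (b n) (real m)" using m(1) b by simp
          also have "\<dots> \<le> b n powr (d + \<epsilon>)" using m(3) b by (intro powr_mono) auto
          finally have "real m / b n \<le> b n powr (d + \<epsilon> - 1)"
            using b by (simp add: powr_diff divide_right_mono)
          then have "(real m / b n) ^ k \<le> (b n powr (d + \<epsilon> - 1)) ^ k"
            using b by (intro power_mono) auto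
          then have "falling_ratio (card (E n)) m k \<le> (b n powr (d + \<epsilon> - 1)) ^ k"
            using falling_ratio_le_power[OF True m(2)] by (simp add: b_def)
          then have "real (card (X n)) * falling_ratio (card (E n)) m k \<le>
              (b n ^ k) powr r * (b n powr (d + \<epsilon> - 1)) ^ k"
            using cX falling_ratio_pos[OF True m(2)] by (intro mult_mono) auto
          also have "\<dots> = b n powr (real k * r + real k * (d + \<epsilon> - 1))"
          proof -
            have "b n ^ k = b n powr real k" using b by (simp add: powr_realpow)
            then show ?thesis using b by (simp add: powr_add powr_powr powr_power)
          qed
          also have "real k * r + real k * (d + \<epsilon> - 1) = - (real k * \<epsilon>)"
            by (simp add: \<epsilon>_def field_simps)
          finally show "real (card (X n)) * falling_ratio (card (E n)) m k \<le> \<delta> n" by (simp add: \<delta>_def)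
        qed simp
        finally show ?thesis .
      next
        case False
        \<comment> \<open>Sizes m < k fall outside the moment formula, but such sets contain no
          k-tuple at all.\<close>
        have "distinct_tuples k a \<inter> X n = {}" if "a \<subseteq> E n" "card a = m" for a
        proof -
          have "finite a" using that E finite_subset by blast
          then have "length xs \<noteq> k" if "set xs \<subseteq> a" "distinct xs" for xs
            using that False \<open>card a = m\<close> by (metis card_mono distinct_card)
          then show ?thesis by (auto simp: distinct_tuples_def)
        qed
        then have "{a. a \<subseteq> E n \<and> card a = m \<and> distinct_tuples k a \<inter> X n \<noteq> {}} = {}" by auto
        then show ?thesis unfolding \<delta>_def by (metis card.empty of_nat_0 mult_nonneg_nonneg of_nat_0_le_iff powr_ge_zero)
      qed
      moreover have "0 \<le> \<delta> n" by (simp add: \<delta>_def)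
      ultimately show ?case by (auto simp: b_def)
    qed
  qed
  then have "(\<lambda>n. 1 - measure (M n) {\<omega> \<in> space (M n). distinct_tuples k (A n \<omega>) \<inter> X n \<noteq> {}}) \<longlonglongrightarrow> 1 - 0"
    by (intro tendsto_intros)
  moreover have "measure (M n) {\<omega> \<in> space (M n). distinct_tuples k (A n \<omega>) \<inter> X n = {}} =
      1 - measure (M n) {\<omega> \<in> space (M n). distinct_tuples k (A n \<omega>) \<inter> X n \<noteq> {}}" for n
  proof -
    interpret prob_space "M n" using rs by (simp add: random_subset_def)
    show ?thesis
      using prob_neg[of "\<lambda>\<omega>. distinct_tuples k (A n \<omega>) \<inter> X n \<noteq> {}"]
        random_subset_sets[OF rs, where P = "\<lambda>a. distinct_tuples k a \<inter> X n \<noteq> {}"] by simp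
  qed
  ultimately show ?thesis by (simp add: asymptotically_almost_surely_def)
qed

section \<open>The dense case: concentration of the number of tuples\<close>

text \<open>Translates the small self-intersection condition to powers of |E|. A density below r in
  a set of at most |E|^(2k) pairs gives s = 2kr, and multiplying the condition by 2k yields the
  strict inequality that makes |Y_i| (N/m)^i negligible against |X|^2.\<close>

lemma eventually_card_self_intersection_le:
  assumes k: "k \<ge> 1" and E: "\<And>n. finite (E n)"
    and N: "filterlim (\<lambda>n. card (E n)) at_top sequentially"
    and XT: "\<And>n. X n \<subseteq> distinct_tuples k (E n)"
    and small: "small_self_intersection k E X (ereal a) d" and i: "1 \<le> i" "i \<le> k - 1"
  obtains s where "s + real i * (1 - d) < 2 * real k * a"
    "\<forall>\<^sub>F n in sequentially. real (card (self_intersection (X n) i)) \<le> real (card (E n)) powr s"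
proof -
  let ?T = "\<lambda>n. distinct_tuples k (E n)"
  have "limsup (\<lambda>n. dens (?T n \<times> ?T n) (self_intersection (X n) i)) < ereal (a - (1 - d) * (real i / (2 * real k)))"
    using small i by (simp add: small_self_intersection_def upper_dens_def)
  then obtain r where r: "limsup (\<lambda>n. dens (?T n \<times> ?T n) (self_intersection (X n) i)) < ereal r"
    "ereal r < ereal (a - (1 - d) * (real i / (2 * real k)))" using ereal_dense2 by blast
  have ev: "\<forall>\<^sub>F n in sequentially. dens (?T n \<times> ?T n) (self_intersection (X n) i) < ereal r"
    by (rule Limsup_lessD[OF r(1)])
  have evN: "\<forall>\<^sub>F n in sequentially. max 4 (2 * k) \<le> card (E n)" using N unfolding filterlim_at_top by blast
  show thesis
  proof (rule that)
    show "2 * real k * r + real i * (1 - d) < 2 * real k * a"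
      using r(2) k by (simp add: field_simps)
    show "\<forall>\<^sub>F n in sequentially. real (card (self_intersection (X n) i)) \<le> real (card (E n)) powr (2 * real k * r)"
      using ev evN
    proof eventually_elim
      case (elim n)
      define b where "b = real (card (E n))"
      have b: "4 \<le> b" using elim by (simp add: b_def)
      have "2 ^ 1 \<le> (b / 2) ^ 1" using b by simp
      also have "\<dots> \<le> (b / 2) ^ k" using b k by (intro power_increasing) auto
      also have "\<dots> \<le> real (card (?T n))"
        using card_distinct_tuples_ge[OF E, of k n] elim by (simp add: b_def)
      finally have "2 \<le> card (?T n)" by simp
      then have T: "1 < card (?T n \<times> ?T n)"
        using mult_le_mono[of 2 "card (?T n)" 2 "card (?T n)"] by (simp add: card_cartesian_product)
      have T': "real (card (?T n)) \<le> b ^ k"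
        using card_distinct_tuples_le[OF E, of k n] unfolding b_def by (metis of_nat_le_iff of_nat_power)
      have "real (card (?T n \<times> ?T n)) \<le> b ^ k * b ^ k"
        unfolding card_cartesian_product of_nat_mult using T' b by (intro mult_mono) auto
      also have "\<dots> = b powr (2 * real k)" 
        using b powr_add[of b "real k" "real k"] by (simp add: powr_realpow)
      finally have le: "real (card (?T n \<times> ?T n)) \<le> b powr (2 * real k)" .
      have "self_intersection (X n) i \<subseteq> ?T n \<times> ?T n" using XT by (auto simp: self_intersection_def)
      then have fin: "finite (self_intersection (X n) i)"
        using finite_distinct_tuples[OF E] finite_subset by blast
      show ?case
        using card_le_powr_of_dens_less[OF elim(1) fin T le] by (simp add: powr_powr b_def)
    qed
  qed
qed

text \<open>Meant for Y = |Y_i|, Z = |X| and w = i(1 - d + \<epsilon>), one term of the relative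
  variance. The quotient is at most a constant times a negative power of b.\<close>

lemma self_intersection_term_tendsto_0:
  fixes b Y Z :: "nat \<Rightarrow> real"
  assumes b: "filterlim b at_top sequentially"
    and Y: "\<forall>\<^sub>F n in sequentially. 0 \<le> Y n \<and> Y n \<le> K * b n powr s"
    and Z: "\<forall>\<^sub>F n in sequentially. b n powr z \<le> Z n"
    and "s + w < 2 * z"
  shows "(\<lambda>n. Y n * b n powr w / (Z n)\<^sup>2) \<longlonglongrightarrow> 0"
proof -
  have "(\<lambda>n. K * b n powr (s + w - 2 * z)) \<longlonglongrightarrow> K * 0"
    using assms(4) by (intro tendsto_mult tendsto_const tendsto_neg_powr b) auto
  then have lim: "(\<lambda>n. K * b n powr (s + w - 2 * z)) \<longlonglongrightarrow> 0" by simp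
  have b0: "\<forall>\<^sub>F n in sequentially. 0 < b n" using b by (simp add: filterlim_at_top_dense)
  show ?thesis
  proof (rule tendsto_sandwich[OF _ _ tendsto_const lim])
    show "\<forall>\<^sub>F n in sequentially. 0 \<le> Y n * b n powr w / (Z n)\<^sup>2"
      using Y by eventually_elim simp
    show "\<forall>\<^sub>F n in sequentially. Y n * b n powr w / (Z n)\<^sup>2 \<le> K * b n powr (s + w - 2 * z)"
      using Y Z b0
    proof eventually_elim
      case (elim n)
      have "Y n * b n powr w / (Z n)\<^sup>2 \<le> K * b n powr s * b n powr w / (b n powr z)\<^sup>2"
        using elim by (intro frac_le mult_right_mono power_mono) auto
      also have "\<dots> = K * b n powr (s + w - 2 * z)"
        using elim by (simp add: powr_add powr_diff powr_power)
      finally show ?case .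
    qed
  qed
qed

text \<open>In logarithms, multiplicative errors become additive constants: one ln 2 for Z against
  its mean x p, and k ln 2 for p against q^k.\<close>

lemma ln_deviation_le:
  fixes Z x p q :: real
  assumes "0 < x" "0 < q" "\<bar>Z - x * p\<bar> \<le> x * p / 2" "(q / 2) ^ k \<le> p" "p \<le> q ^ k"
  shows "0 < Z" "\<bar>ln Z - ln x - real k * ln q\<bar> \<le> (real k + 1) * ln 2"
proof -
  have p: "0 < p" using assms(2,4) by (meson less_le_trans half_gt_zero zero_less_power)
  then have xp: "0 < x * p" using assms by simp
  then have *: "x * p / 2 \<le> Z" "Z \<le> 2 * (x * p)" using assms(3) by linarith+
  then show Z: "0 < Z" using xp by linarith
  have 1: "ln (x * p / 2) \<le> ln Z" "ln Z \<le> ln (2 * (x * p))"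
    using * Z xp by (subst ln_le_cancel_iff; simp)+
  have "ln ((q / 2) ^ k) \<le> ln p" "ln p \<le> ln (q ^ k)"
    using p assms by (subst ln_le_cancel_iff; simp)+
  then have 2: "real k * (ln q - ln 2) \<le> ln p" "ln p \<le> real k * ln q"
    using assms by (simp_all add: ln_realpow ln_div)
  have 3: "ln (x * p / 2) = ln x + ln p - ln 2" "ln (2 * (x * p)) = ln 2 + (ln x + ln p)"
    using assms p by (simp_all add: ln_div ln_mult)
  have "0 \<le> real k * ln 2" by simp
  then show "\<bar>ln Z - ln x - real k * ln q\<bar> \<le> (real k + 1) * ln 2"
    using 1 2 unfolding 3 by (simp add: algebra_simps abs_le_iff)
qed

text \<open>A deterministic estimate for one set \<open>a\<close> with a typical count. The factor
  \<rho> corrects for the base |E^(k)| in place of |E|^k and will tend to 1. Of the four errors, all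
  but \<rho> \<epsilon> will vanish in the limit.\<close>

lemma tuples_density_deviation:
  fixes X :: "'a list set"
  assumes E: "finite E" and X: "X \<subseteq> distinct_tuples k E" and X0: "X \<noteq> {}" and a: "a \<subseteq> E"
    and m: "2 * k \<le> card a" "0 < card a" and N: "1 < card E" and T: "1 < card (distinct_tuples k E)"
    and u: "\<bar>log (real (card E)) (real (card a)) - d\<bar> \<le> \<epsilon>" "d \<le> 1"
    and close: "\<bar>real (card (distinct_tuples k a \<inter> X)) - real (card X) * falling_ratio (card E) (card a) k\<bar>
      \<le> real (card X) * falling_ratio (card E) (card a) k / 2"
  defines "\<tau> \<equiv> ln (real (card (distinct_tuples k E)))"
  defines "\<rho> \<equiv> real k * ln (real (card E)) / \<tau>"
  shows "\<exists>z. dens (distinct_tuples k E) (distinct_tuples k a \<inter> X) = ereal z \<and>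
    \<bar>z - (\<alpha> + d - 1)\<bar> \<le> \<bar>ln (real (card X)) / \<tau> - \<alpha>\<bar> + \<rho> * \<epsilon> + \<bar>\<rho> - 1\<bar> * (1 - d) + (real k + 1) * ln 2 / \<tau>"
proof -
  let ?Z = "real (card (distinct_tuples k a \<inter> X))"
  let ?x = "real (card X)"
  let ?N = "real (card E)"
  let ?q = "real (card a) / ?N"
  have fX: "finite X" using X E finite_distinct_tuples finite_subset by blast
  then have x: "0 < ?x" using X0 by (simp add: card_gt_0_iff)
  have aE: "card a \<le> card E" using a E card_mono by blast
  have q: "0 < ?q" using m N by simp
  have \<tau>: "0 < \<tau>" using T by (simp add: \<tau>_def)
  have L: "0 < ln ?N" using N by simp
  have "(?q / 2) ^ k \<le> falling_ratio (card E) (card a) k"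
    using power_le_falling_ratio[OF m(1) aE] by (simp add: mult.commute)
  moreover have "falling_ratio (card E) (card a) k \<le> ?q ^ k"
    using m aE by (intro falling_ratio_le_power) auto
  ultimately have Z: "0 < ?Z" and dev: "\<bar>ln ?Z - ln ?x - real k * ln ?q\<bar> \<le> (real k + 1) * ln 2"
    using ln_deviation_le[OF x q close] by blast+
  let ?D = "ln ?Z - ln ?x - real k * ln ?q"
  let ?u = "log ?N (real (card a))"
  have "ln ?q = ln ?N * (?u - 1)" using m N L by (simp add: ln_div log_def field_simps)
  then have "real k * ln ?q / \<tau> = \<rho> * (?u - 1)" by (simp add: \<rho>_def)
  then have "?D / \<tau> = ln ?Z / \<tau> - ln ?x / \<tau> - \<rho> * (?u - 1)"
    by (simp only: diff_divide_distrib)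
  \<comment> \<open>The main term \<rho>(u - 1) is rewritten as (d - 1) + \<rho>(u - d) + (\<rho> -
    1)(d - 1), which separates the error in |a| from the error in the base.\<close>
  then have eq: "ln ?Z / \<tau> - (\<alpha> + d - 1) =
      ?D / \<tau> + (ln ?x / \<tau> - \<alpha>) + \<rho> * (?u - d) + (\<rho> - 1) * (d - 1)"
    by (simp only:) (simp add: algebra_simps)
  have "\<bar>?D / \<tau>\<bar> \<le> (real k + 1) * ln 2 / \<tau>"
    using dev \<tau> by (simp add: divide_right_mono)
  moreover have "\<bar>\<rho> * (?u - d)\<bar> \<le> \<rho> * \<epsilon>"
    using u \<tau> L unfolding abs_mult by (intro mult_mono) (auto simp: \<rho>_def)
  moreover have "\<bar>(\<rho> - 1) * (d - 1)\<bar> = \<bar>\<rho> - 1\<bar> * (1 - d)"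
    using u(2) by (simp add: abs_mult)
  ultimately have "\<bar>ln ?Z / \<tau> - (\<alpha> + d - 1)\<bar> \<le>
      \<bar>ln ?x / \<tau> - \<alpha>\<bar> + \<rho> * \<epsilon> + \<bar>\<rho> - 1\<bar> * (1 - d) + (real k + 1) * ln 2 / \<tau>"
    unfolding eq by linarith
  moreover have "dens (distinct_tuples k E) (distinct_tuples k a \<inter> X) = ereal (ln ?Z / \<tau>)"
    using Z by (auto simp: dens_def log_def \<tau>_def)
  ultimately show ?thesis by blast
qed

text \<open>Order of choices: a neighbourhood U of the limit fixes e; then \<epsilon> is taken below
  e, below d and below the thresholds of all k variance terms, so that one window for |A| serves
  both the density estimate and Chebyshev's bound.\<close>

lemma tuples_second_moment:
  fixes X :: "nat \<Rightarrow> 'a list set" and a d :: real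
  assumes k: "k \<ge> 1" and E: "\<And>n. finite (E n)"
    and N: "filterlim (\<lambda>n. card (E n)) at_top sequentially"
    and d: "0 < d" "d < 1"
    and R: "random_densable M E A (ereal d)"
    and inv: "\<And>n. permutation_invariant (M n) (E n) (A n)"
    and X: "densable (\<lambda>n. distinct_tuples k (E n)) X (ereal a)"
    and gt: "d + a > 1"
    and small: "small_self_intersection k E X (ereal a) d"
  shows "random_densable M (\<lambda>n. distinct_tuples k (E n))
    (\<lambda>n \<omega>. distinct_tuples k (A n \<omega>) \<inter> X n) (ereal (a + d - 1))"
proof -
  let ?T = "\<lambda>n. distinct_tuples k (E n)"
  have rs: "random_subset (M n) (E n) (A n)" for n using R by (simp add: random_densable_def)
  have XT: "X n \<subseteq> ?T n" for n using X by (simp add: densable_def)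
  have fX: "finite (X n)" for n using XT E finite_distinct_tuples finite_subset by blast
  have a: "0 \<le> a" "a \<le> 1" using X by (auto simp: densable_def density_values_def)
  have rs': "random_subset (M n) (?T n) (\<lambda>\<omega>. distinct_tuples k (A n \<omega>) \<inter> X n)" for n
    by (rule random_subset_tuples[OF rs XT])

  define b where "b n = real (card (E n))" for n
  define \<tau> where "\<tau> n = ln (real (card (?T n)))" for n
  define \<rho> where "\<rho> n = real k * ln (b n) / \<tau> n" for n
  have bt: "filterlim b at_top sequentially"
    unfolding b_def by (intro filterlim_compose[OF filterlim_real_sequentially N])
  have lt: "filterlim (\<lambda>n. ln (b n)) at_top sequentially"
    by (rule filterlim_compose[OF ln_at_top bt])
  have b_ge: "\<forall>\<^sub>F n in sequentially. c \<le> b n" for c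
    using bt unfolding filterlim_at_top by blast
  have rat: "(\<lambda>n. \<tau> n / ln (b n)) \<longlonglongrightarrow> real k"
    unfolding \<tau>_def b_def by (rule ln_card_distinct_tuples_ratio[OF E N])
  have "filterlim (\<lambda>n. (\<tau> n / ln (b n)) * ln (b n)) at_top sequentially"
    using k by (intro filterlim_tendsto_pos_mult_at_top[OF rat _ lt]) auto
  moreover have "\<forall>\<^sub>F n in sequentially. (\<tau> n / ln (b n)) * ln (b n) = \<tau> n"
    using b_ge[of 2] by eventually_elim simp
  ultimately have \<tau>t: "filterlim \<tau> at_top sequentially"
    using filterlim_cong[OF refl refl] by fast
  have T1: "\<forall>\<^sub>F n in sequentially. 1 < card (?T n)"
  proof -
    \<comment> \<open>With 0 or 1 tuples \<open>\<tau> n\<close> would be 0, as \<open>ln 0\<close>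
      is 0; positivity therefore gives at least two.\<close>
    have "\<forall>\<^sub>F n in sequentially. 0 < \<tau> n" using \<tau>t unfolding filterlim_at_top_dense by blast
    then show ?thesis
    proof eventually_elim
      case (elim n)
      then show ?case by (cases "card (?T n)") (auto simp: \<tau>_def intro!: Suc_lessI gr0I)
    qed
  qed
  have "(\<lambda>n. real k * inverse (\<tau> n / ln (b n))) \<longlonglongrightarrow> real k * inverse (real k)"
    using k by (intro tendsto_intros rat) auto
  then have \<rho>: "\<rho> \<longlonglongrightarrow> 1" using k by (simp add: \<rho>_def[abs_def])

  have dX: "(\<lambda>n. dens (?T n) (X n)) \<longlonglongrightarrow> ereal a" using X by (simp add: densable_def)
  then have "\<forall>\<^sub>F n in sequentially. - \<infinity> < dens (?T n) (X n)" by (rule order_tendstoD(1)) simp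
  then have X0: "\<forall>\<^sub>F n in sequentially. X n \<noteq> {}" by eventually_elim (auto simp: dens_def)
  have "(\<lambda>n. ereal (ln (real (card (X n))) / \<tau> n)) \<longlonglongrightarrow> ereal a"
  proof (rule Lim_transform_eventually[OF dX])
    show "\<forall>\<^sub>F n in sequentially. dens (?T n) (X n) = ereal (ln (real (card (X n))) / \<tau> n)"
      using X0 by eventually_elim (simp add: dens_def log_def \<tau>_def)
  qed
  then have \<kappa>: "(\<lambda>n. ln (real (card (X n))) / \<tau> n) \<longlonglongrightarrow> a" by simp
  \<comment> \<open>Change of base: |X| = N^(k a + o(1)), as the product of log |X| to base |E^(k)|
    with \<tau> / ln N tends to a k.\<close>
  have X_bounds: "\<forall>\<^sub>F n in sequentially. b n powr (real k * a - \<eta>) \<le> real (card (X n)) \<and>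
      real (card (X n)) \<le> b n powr (real k * a + \<eta>)" if "0 < \<eta>" for \<eta>
  proof -
    have "(\<lambda>n. (ln (real (card (X n))) / \<tau> n) * (\<tau> n / ln (b n))) \<longlonglongrightarrow> a * real k"
      by (intro tendsto_intros \<kappa> rat)
    then have "\<forall>\<^sub>F n in sequentially. dist ((ln (real (card (X n))) / \<tau> n) * (\<tau> n / ln (b n))) (a * real k) < \<eta>"
      using that by (rule tendstoD)
    then show ?thesis using X0 T1 b_ge[of 2]
    proof eventually_elim
      case (elim n)
      have L: "0 < ln (b n)" using elim by simp
      have x: "0 < real (card (X n))" using elim fX[of n] by (simp add: card_gt_0_iff)
      have "\<tau> n \<noteq> 0" using elim by (simp add: \<tau>_def)
      then have "\<bar>ln (real (card (X n))) / ln (b n) - a * real k\<bar> < \<eta>" using elim by (simp add: dist_real_def)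
      then have 1: "\<bar>log (b n) (real (card (X n))) - a * real k\<bar> < \<eta>" by (simp add: log_def)
      have 2: "real (card (X n)) = b n powr log (b n) (real (card (X n)))" using x elim by simp
      have "b n powr (real k * a - \<eta>) \<le> b n powr log (b n) (real (card (X n)))"
        "b n powr log (b n) (real (card (X n))) \<le> b n powr (real k * a + \<eta>)"
        using 1 elim by (intro powr_mono; simp add: algebra_simps abs_less_iff)+
      then show ?case using 2 by simp
    qed
  qed

  \<comment> \<open>One form for all i: for i < k the bound is the self-intersection condition, for
    i = k it comes from d + a > 1 and the count by k^k |X|.\<close>
  have Y_bound: "\<exists>s K. s + real i * (1 - d) < 2 * real k * a \<and>
      (\<forall>\<^sub>F n in sequentially. real (card (self_intersection (X n) i)) \<le> K * b n powr s)"
    if i: "i \<in> {1..k}" for i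
  proof (cases "i = k")
    case True
    \<comment> \<open>The required inequality k a + \<eta> + k(1 - d) < 2 k a means \<eta> < k(a + d
      - 1); half of that is taken.\<close>
    define \<eta> where "\<eta> = real k * (a + d - 1) / 2"
    have \<eta>: "0 < \<eta>" using k gt by (simp add: \<eta>_def)
    have "\<forall>\<^sub>F n in sequentially. real (card (self_intersection (X n) i)) \<le> real (k ^ k) * b n powr (real k * a + \<eta>)"
      using X_bounds[OF \<eta>]
    proof eventually_elim
      case (elim n)
      have "real (card (self_intersection (X n) k)) \<le> real (k ^ k) * real (card (X n))"
        using card_self_intersection_top_le[OF XT E, of n] by (metis of_nat_le_iff of_nat_mult)
      also have "\<dots> \<le> real (k ^ k) * b n powr (real k * a + \<eta>)"
        using elim by (intro mult_left_mono) auto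
      finally show ?case using True by simp
    qed
    moreover have "(real k * a + \<eta>) + real i * (1 - d) < 2 * real k * a"
      using \<eta> True by (simp add: \<eta>_def field_simps)
    ultimately show ?thesis by blast
  next
    case False
    then have i': "1 \<le> i" "i \<le> k - 1" using i by auto
    obtain s where "s + real i * (1 - d) < 2 * real k * a"
      "\<forall>\<^sub>F n in sequentially. real (card (self_intersection (X n) i)) \<le> real (card (E n)) powr s"
      using eventually_card_self_intersection_le[OF k E N XT small i'] .
    then show ?thesis by (intro exI[of _ s] exI[of _ 1]) (simp add: b_def)
  qed
  \<comment> \<open>Stated for all small \<epsilon>, so that the finitely many indices i can later
    share a single \<epsilon>.\<close>
  have term0: "\<forall>\<^sub>F \<epsilon> in at_right 0. (\<lambda>n. real (card (self_intersection (X n) i)) *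
      b n powr (real i * (1 - d + \<epsilon>)) / (real (card (X n)))\<^sup>2) \<longlonglongrightarrow> 0" if i: "i \<in> {1..k}" for i
  proof -
    obtain s K where s: "s + real i * (1 - d) < 2 * real k * a"
      and Y: "\<forall>\<^sub>F n in sequentially. real (card (self_intersection (X n) i)) \<le> K * b n powr s"
      using Y_bound[OF i] by blast
    \<comment> \<open>The slack \<gamma> is spent in parts: less than \<gamma>/4 on i \<epsilon>,
      and \<gamma>/2 on the lower bound for |X|, whose exponent loses \<gamma>/4 before
      squaring.\<close>
    define \<gamma> where "\<gamma> = 2 * real k * a - s - real i * (1 - d)"
    have \<gamma>: "0 < \<gamma>" using s by (simp add: \<gamma>_def)
    have "\<forall>\<^sub>F \<epsilon> in at_right 0. \<epsilon> \<in> {0<..<\<gamma> / (4 * real i)}"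
      using \<gamma> i by (intro eventually_at_right_real) auto
    then show ?thesis
    proof eventually_elim
      case (elim \<epsilon>)
      then have "real i * \<epsilon> < \<gamma> / 4" using i by (simp add: field_simps)
      then have "2 * (real k * a) - \<gamma> + real i * \<epsilon> < 2 * (real k * a - \<gamma> / 4)"
        using \<gamma> by argo
      moreover have "s + real i * (1 - d + \<epsilon>) = 2 * (real k * a) - \<gamma> + real i * \<epsilon>"
        by (simp add: \<gamma>_def algebra_simps)
      ultimately have "s + real i * (1 - d + \<epsilon>) < 2 * (real k * a - \<gamma> / 4)"
        by simp
      moreover have "\<forall>\<^sub>F n in sequentially. b n powr (real k * a - \<gamma> / 4) \<le> real (card (X n))"
        using X_bounds[of "\<gamma> / 4"] \<gamma> by (simp add: eventually_conj_iff)
      moreover have "\<forall>\<^sub>F n in sequentially. 0 \<le> real (card (self_intersection (X n) i)) \<and>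
          real (card (self_intersection (X n) i)) \<le> K * b n powr s"
        using Y by simp
      ultimately show ?case by (intro self_intersection_term_tendsto_0[OF bt])
    qed
  qed

  have "weakly_converges (\<lambda>n. distr (M n) borel (\<lambda>\<omega>. dens (?T n) (distinct_tuples k (A n \<omega>) \<inter> X n)))
      (return borel (ereal (a + d - 1)))"
  proof (rule weakly_converges_return)
    show "prob_space (M n)" for n using rs by (simp add: random_subset_def)
    show "(\<lambda>\<omega>. dens (?T n) (distinct_tuples k (A n \<omega>) \<inter> X n)) \<in> borel_measurable (M n)" for n
      by (rule measurable_dens[OF rs'])
  next
    fix U :: "ereal set" assume U: "open U" "ereal (a + d - 1) \<in> U"
    \<comment> \<open>The limit is finite, so U contains a real interval around it, and it is enough
      to produce a finite density within e.\<close>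
    have "open (ereal -` U)"
      by (rule open_vimage[OF U(1)]) (intro continuous_on_ereal continuous_on_id)
    then obtain e where e: "0 < e" and eU: "\<And>z. \<bar>z - (a + d - 1)\<bar> < e \<Longrightarrow> ereal z \<in> U"
      using U(2) by (auto simp: open_dist dist_real_def)
    have "\<forall>\<^sub>F \<epsilon> in at_right 0. \<epsilon> \<in> {0<..<min e d}"
      using e d by (intro eventually_at_right_real) auto
    moreover have "\<forall>\<^sub>F \<epsilon> in at_right 0. \<forall>i\<in>{1..k}. (\<lambda>n. real (card (self_intersection (X n) i)) *
      b n powr (real i * (1 - d + \<epsilon>)) / (real (card (X n)))\<^sup>2) \<longlonglongrightarrow> 0"
      using term0 by (intro eventually_ball_finite) auto
    ultimately have "\<forall>\<^sub>F \<epsilon> in at_right 0. \<epsilon> \<in> {0<..<min e d} \<and>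
      (\<forall>i\<in>{1..k}. (\<lambda>n. real (card (self_intersection (X n) i)) *
      b n powr (real i * (1 - d + \<epsilon>)) / (real (card (X n)))\<^sup>2) \<longlonglongrightarrow> 0)"
      by (rule eventually_conj)
    from eventually_happens'[OF trivial_limit_at_right_real this]
    obtain \<epsilon> where \<epsilon>: "0 < \<epsilon>" "\<epsilon> < e" "\<epsilon> < d"
      and t0: "\<And>i. i \<in> {1..k} \<Longrightarrow> (\<lambda>n. real (card (self_intersection (X n) i)) *
      b n powr (real i * (1 - d + \<epsilon>)) / (real (card (X n)))\<^sup>2) \<longlonglongrightarrow> 0"
      by auto
    define \<delta> where "\<delta> n = 4 ^ Suc k * (\<Sum>i=1..k. real (card (self_intersection (X n) i)) *
      b n powr (real i * (1 - d + \<epsilon>)) / (real (card (X n)))\<^sup>2)" for n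
    have "\<delta> \<longlonglongrightarrow> 4 ^ Suc k * (\<Sum>i=1..k. 0)"
      unfolding \<delta>_def by (intro tendsto_mult tendsto_const tendsto_sum t0)
    then have \<delta>: "\<delta> \<longlonglongrightarrow> 0" by simp
    \<comment> \<open>The deviation bound tends to \<epsilon>, which was chosen below e, so it is
      eventually below e.\<close>
    have "(\<lambda>n. \<bar>ln (real (card (X n))) / \<tau> n - a\<bar> + \<rho> n * \<epsilon> + \<bar>\<rho> n - 1\<bar> * (1 - d) + (real k + 1) * ln 2 * inverse (\<tau> n))
        \<longlonglongrightarrow> \<bar>a - a\<bar> + 1 * \<epsilon> + \<bar>1 - 1\<bar> * (1 - d) + (real k + 1) * ln 2 * 0"
      by (intro tendsto_intros \<kappa> \<rho> tendsto_inverse_0_at_top \<tau>t)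
    then have h: "\<forall>\<^sub>F n in sequentially. \<bar>ln (real (card (X n))) / \<tau> n - a\<bar> + \<rho> n * \<epsilon> +
        \<bar>\<rho> n - 1\<bar> * (1 - d) + (real k + 1) * ln 2 * inverse (\<tau> n) < e"
      by (rule order_tendstoD(2)) (use \<epsilon> in simp)
    \<comment> \<open>Every size m in the window is at least N^(d - \<epsilon>), which is unbounded
      because \<epsilon> < d; this secures the hypothesis 2k \<le> m of the moment bounds.\<close>
    have "(\<lambda>n. b n powr - (d - \<epsilon>)) \<longlonglongrightarrow> 0" using \<epsilon> by (intro tendsto_neg_powr bt) auto
    then have m_large: "\<forall>\<^sub>F n in sequentially. b n powr - (d - \<epsilon>) < 1 / (2 * real k)"
      using k by (intro order_tendstoD(2)) auto
    show "(\<lambda>n. measure (M n) {\<omega> \<in> space (M n). dens (?T n) (distinct_tuples k (A n \<omega>) \<inter> X n) \<notin> U}) \<longlonglongrightarrow> 0"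
    proof (rule bad_event_tendsto_0[OF R E inv \<epsilon>(1) \<delta>,
        where B = "\<lambda>n S. dens (?T n) (distinct_tuples k S \<inter> X n) \<notin> U"])
      show "\<forall>\<^sub>F n in sequentially. 0 \<le> \<delta> n \<and>
        (\<forall>m. 0 < m \<longrightarrow> m \<le> card (E n) \<longrightarrow> \<bar>log (real (card (E n))) (real m) - d\<bar> < \<epsilon> \<longrightarrow>
          real (card {S. S \<subseteq> E n \<and> card S = m \<and> dens (?T n) (distinct_tuples k S \<inter> X n) \<notin> U})
            \<le> \<delta> n * real (card (E n) choose m))"
        using h m_large T1 X0 b_ge[of 2]
      proof eventually_elim
        case (elim n)
        have "real (card {S. S \<subseteq> E n \<and> card S = m \<and> dens (?T n) (distinct_tuples k S \<inter> X n) \<notin> U})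
            \<le> \<delta> n * real (card (E n) choose m)"
          if m: "0 < m" "m \<le> card (E n)" "\<bar>log (b n) (real m) - d\<bar> < \<epsilon>" for m
        proof -
          have "b n powr (d - \<epsilon>) \<le> b n powr log (b n) (real m)"
            using m elim by (intro powr_mono) auto
          then have m_ge: "b n powr (d - \<epsilon>) \<le> real m" using m elim by simp
          have "1 / b n powr (d - \<epsilon>) < 1 / (2 * real k)"
            using elim(2) by (simp only: powr_minus_divide)
          moreover have "0 < b n powr (d - \<epsilon>)" using elim by simp
          ultimately have "2 * real k < b n powr (d - \<epsilon>)"
            using k by (simp add: field_simps)
          then have 2: "2 * k \<le> m" using m_ge by linarith
          let ?\<mu> = "real (card (X n)) * falling_ratio (card (E n)) m k"
          \<comment> \<open>By contraposition: a count within half of its mean puts the density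
            within e of a + d - 1, hence in U.\<close>
          have "{S. S \<subseteq> E n \<and> card S = m \<and> dens (?T n) (distinct_tuples k S \<inter> X n) \<notin> U} \<subseteq>
            {S. S \<subseteq> E n \<and> card S = m \<and> ?\<mu> / 2 < \<bar>real (card (distinct_tuples k S \<inter> X n)) - ?\<mu>\<bar>}"
          proof
            fix S assume "S \<in> {S. S \<subseteq> E n \<and> card S = m \<and> dens (?T n) (distinct_tuples k S \<inter> X n) \<notin> U}"
            then have S: "S \<subseteq> E n" "m = card S" "dens (?T n) (distinct_tuples k S \<inter> X n) \<notin> U" by auto
            let ?\<mu>S = "real (card (X n)) * falling_ratio (card (E n)) (card S) k"
            have "?\<mu>S / 2 < \<bar>real (card (distinct_tuples k S \<inter> X n)) - ?\<mu>S\<bar>"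
            proof (rule ccontr)
              assume "\<not> ?\<mu>S / 2 < \<bar>real (card (distinct_tuples k S \<inter> X n)) - ?\<mu>S\<bar>"
              then have close: "\<bar>real (card (distinct_tuples k S \<inter> X n)) - ?\<mu>S\<bar> \<le> ?\<mu>S / 2" by simp
              have pre: "2 * k \<le> card S" "0 < card S" "1 < card (E n)"
                "\<bar>log (real (card (E n))) (real (card S)) - d\<bar> \<le> \<epsilon>" "d \<le> 1"
                using 2 m S d elim by (auto simp: b_def)
              obtain z where z: "dens (?T n) (distinct_tuples k S \<inter> X n) = ereal z"
                "\<bar>z - (a + d - 1)\<bar> \<le> \<bar>ln (real (card (X n))) / \<tau> n - a\<bar> + \<rho> n * \<epsilon> +
                  \<bar>\<rho> n - 1\<bar> * (1 - d) + (real k + 1) * ln 2 / \<tau> n"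
                using tuples_density_deviation[OF E XT elim(4) S(1) pre(1-3) elim(3) pre(4,5) close, of a]
                unfolding \<tau>_def \<rho>_def b_def by blast
              then have "\<bar>z - (a + d - 1)\<bar> < e" using elim(1) by (simp add: divide_inverse)
              then show False using eU z(1) S(3) by simp
            qed
            then show "S \<in> {S. S \<subseteq> E n \<and> card S = m \<and>
                ?\<mu> / 2 < \<bar>real (card (distinct_tuples k S \<inter> X n)) - ?\<mu>\<bar>}"
              using S by simp
          qed
          then have "real (card {S. S \<subseteq> E n \<and> card S = m \<and> dens (?T n) (distinct_tuples k S \<inter> X n) \<notin> U}) \<le>
              real (card {S. S \<subseteq> E n \<and> card S = m \<and> ?\<mu> / 2 < \<bar>real (card (distinct_tuples k S \<inter> X n)) - ?\<mu>\<bar>})"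
            using E by (intro of_nat_mono card_mono) auto
          also have "\<dots> \<le> 4 ^ Suc k * (\<Sum>i=1..k. real (card (self_intersection (X n) i)) * (b n / real m) ^ i) /
              (real (card (X n)))\<^sup>2 * real (card (E n) choose m)"
            unfolding b_def by (rule card_far_from_mean_le[OF E XT 2 m(2,1) elim(4)])
          also have "\<dots> \<le> \<delta> n * real (card (E n) choose m)"
          proof (intro mult_right_mono)
            \<comment> \<open>Using the smallest size in the window makes the bound \<delta>
              independent of m.\<close>
            have "b n / real m \<le> b n / b n powr (d - \<epsilon>)"
              using m_ge elim m by (intro divide_left_mono) auto
            also have "\<dots> = b n powr (1 - d + \<epsilon>)"
              using elim powr_diff[of "b n" 1 "d - \<epsilon>"] by (simp add: algebra_simps)
            finally have le: "b n / real m \<le> b n powr (1 - d + \<epsilon>)" .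
            have "(b n / real m) ^ i \<le> b n powr (real i * (1 - d + \<epsilon>))" for i
            proof -
              have "(b n / real m) ^ i \<le> (b n powr (1 - d + \<epsilon>)) ^ i"
                using le elim by (intro power_mono) auto
              then show ?thesis using elim by (simp add: powr_power)
            qed
            then have "(\<Sum>i=1..k. real (card (self_intersection (X n) i)) * (b n / real m) ^ i) \<le>
              (\<Sum>i=1..k. real (card (self_intersection (X n) i)) * b n powr (real i * (1 - d + \<epsilon>)))"
              by (intro sum_mono mult_left_mono) auto
            then show "4 ^ Suc k * (\<Sum>i=1..k. real (card (self_intersection (X n) i)) * (b n / real m) ^ i) /
              (real (card (X n)))\<^sup>2 \<le> \<delta> n"
              unfolding \<delta>_def sum_divide_distrib[symmetric] times_divide_eq_right
              by (intro divide_right_mono mult_left_mono) auto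
          qed simp
          finally show ?thesis .
        qed
        moreover have "0 \<le> \<delta> n" unfolding \<delta>_def by (intro mult_nonneg_nonneg sum_nonneg) auto
        ultimately show ?case by (auto simp: b_def)
      qed
    qed
  qed
  \<comment> \<open>The value a + d - 1 is an admissible density: positive by \<open>gt\<close>, and
    at most 1 since a \<le> 1 and d < 1.\<close>
  then show ?thesis
    using rs' a d gt by (simp add: random_densable_def density_values_def one_ereal_def)
qed

theorem theorem2:
  fixes k :: nat
    and E :: "nat \<Rightarrow> 'a set"
    and M :: "nat \<Rightarrow> 'w measure"
    and A :: "nat \<Rightarrow> 'w \<Rightarrow> 'a set"
    and X :: "nat \<Rightarrow> 'a list set"
    and d :: real
    and \<alpha> :: ereal
  assumes "k \<ge> 1"
    and "\<And>n. finite (E n)"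
    and "filterlim (\<lambda>n. card (E n)) at_top sequentially"
    and "0 < d" and "d < 1"
    and "random_densable M E A (ereal d)"
    and "\<And>n. permutation_invariant (M n) (E n) (A n)"
    and "densable (\<lambda>n. distinct_tuples k (E n)) X \<alpha>"
  shows "(ereal d + \<alpha> < 1 \<longrightarrow>
            asymptotically_almost_surely M (\<lambda>n \<omega>. distinct_tuples k (A n \<omega>) \<inter> X n = {})) \<and>
         (ereal d + \<alpha> > 1 \<and> small_self_intersection k E X \<alpha> d \<longrightarrow>
            random_densable M (\<lambda>n. distinct_tuples k (E n))
              (\<lambda>n \<omega>. distinct_tuples k (A n \<omega>) \<inter> X n) (\<alpha> + ereal d - 1))"
proof (intro conjI impI)
  assume "ereal d + \<alpha> < 1"
  then show "asymptotically_almost_surely M (\<lambda>n \<omega>. distinct_tuples k (A n \<omega>) \<inter> X n = {})"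
    using tuples_first_moment assms by blast
next
  assume gt: "ereal d + \<alpha> > 1 \<and> small_self_intersection k E X \<alpha> d"
  \<comment> \<open>Here \<alpha> is real: \<open>gt\<close> excludes \<open>-\<infinity>\<close>
    and \<open>density_values\<close> excludes \<open>\<infinity>\<close>.\<close>
  have "\<alpha> \<in> density_values" using assms(8) by (simp add: densable_def)
  then obtain a where a: "\<alpha> = ereal a"
    using gt by (cases \<alpha>) (auto simp: density_values_def)
  have "d + a > 1" using gt by (simp add: a one_ereal_def)
  then have "random_densable M (\<lambda>n. distinct_tuples k (E n))
      (\<lambda>n \<omega>. distinct_tuples k (A n \<omega>) \<inter> X n) (ereal (a + d - 1))"
    using assms gt unfolding a by (intro tuples_second_moment) auto
  then show "random_densable M (\<lambda>n. distinct_tuples k (E n))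
      (\<lambda>n \<omega>. distinct_tuples k (A n \<omega>) \<inter> X n) (\<alpha> + ereal d - 1)"
    by (simp add: a one_ereal_def)
qed

end
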